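(* Let $X$ be a complete, locally convex median space with compact intervals. The map $j\colon\overline X\to 2^{\mathcal{H}}$, $\xi\mapsto\sigma_\xi$, takes values in the set of morally measurable ultrafilters on $\mathcal{H}$, and it descends to an isomorphism of median algebras $\overline j\colon\overline X\to\overline{\mathcal{M}}(X)$ extending the monomorphism $X\hookrightarrow\overline{\mathcal{M}}(X)$, $x\mapsto[\sigma_x]$.
   Context: A metric space $(X,d)$ is a median space if for all $x,y,z\in X$ there is a unique point $m(x,y,z)$ lying in $I(x,y)\cap I(y,z)\cap I(z,x)$, where $I(x,y)=\{z\in X\mid d(x,y)=d(x,z)+d(z,y)\}$. $X$ has compact intervals if each $I(x,y)$ is compact. A subset $C\subseteq X$ is convex if $I(x,y)\subseteq C$ for all $x,y\in C$; $X$ is locally convex if every point has a basis of convex neighbourhoods. A halfspace is a nonempty convex subset $\mathfrak{h}\subseteq X$ whose complement $\mathfrak{h}^*=X\setminus\mathfrak{h}$ is also nonempty and convex; $\mathcal{H}$ is the set of halfspaces. An ultrafilter on $\mathcal{H}$ is a subset $\sigma\subseteq\mathcal{H}$ such that any two elements of $\sigma$ intersect and, for every $\mathfrak{h}\in\mathcal{H}$, $\mathfrak{h}\in\sigma$ or $\mathfrak{h}^*\in\sigma$. For $x\in X$, $\sigma_x=\{\mathfrak{h}\in\mathcal{H}\mid x\in\mathfrak{h}\}$. Roller compactification. Let $\mathcal{J}$ be the set of all intervals $I=I(x,y)$ of $X$ (singletons allowed); for $I=I(x,y)$ let $\pi_I\colon X\to I$, $\pi_I(z)=m(x,y,z)$.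 A nonempty intersection of two intervals is an interval. Put $$\overline X=\Big\{(x_I)_I\in\prod_{I\in\mathcal{J}}I\ \Big|\ \pi_{I\cap J}(x_I)=\pi_{I\cap J}(x_J)\ \ \forall I,J\in\mathcal{J},\ I\cap J\neq\emptyset\Big\},$$ with the componentwise median operation; $X$ is identified with its image under the median-preserving injection $x\mapsto(\pi_I(x))_I$. For $\xi=(x_I)_I\in\overline X$, $\sigma_\xi\subseteq\mathcal{H}$ is the set of halfspaces $\mathfrak{h}$ such that $x_I\in\mathfrak{h}$ for some (equivalently, every) $I\in\mathcal{J}$ meeting both $\mathfrak{h}$ and $\mathfrak{h}^*$; it is an ultrafilter, and for $\xi=x\in X$ it agrees with $\sigma_x$. Measure on halfspaces. For $x,y\in X$ put $\mathcal{H}(x|y)=\{\mathfrak{h}\in\mathcal{H}\mid x\notin\mathfrak{h},\ y\in\mathfrak{h}\}$ (a halfspace-interval). Let $\mathcal{B}$ be the $\sigma$-algebra on $\mathcal{H}$ generated by halfspace-intervals and $\nu$ the measure on $\mathcal{B}$ with $\nu(\mathcal{H}(x|y))=d(x,y)$ obtained by Carath\'eodory's extension from the ring of finite disjoint unions of halfspace-intervals (so $\nu(E)=\inf\sum_n d(x_n,y_n)$ over countable covers of $E$ by sets $\mathcal{H}(x_n|y_n)$, and $+\infty$ if there is none); let $\mathcal{B}_0$ be its completion. A subset $E\subseteq\mathcal{H}$ is morally measurable if $E\cap\mathcal{H}(x|y)\in\mathcal{B}_0$ for all $x,y\in X$; for such $E$, $\widehat\nu(E)=\sup\sum_i\nu(E\cap\mathcal{H}(x_i|y_i))$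 over all families of pairwise disjoint halfspace-intervals $\mathcal{H}(x_i|y_i)$. $\overline{\mathcal{M}}(X)$ is the set of morally measurable ultrafilters on $\mathcal{H}$ modulo the relation $\sigma_1\sim\sigma_2$ iff $\widehat\nu(\sigma_1\triangle\sigma_2)=0$. It is a median algebra with median of $[\sigma_1],[\sigma_2],[\sigma_3]$ the class of the set of halfspaces lying in at least two of $\sigma_1,\sigma_2,\sigma_3$. *)

theory Defs
  imports "HOL-Analysis.Analysis"
begin

section \<open>Median spaces and median algebras\<close>

definition (in dist) interval :: "'a \<Rightarrow> 'a \<Rightarrow> 'a set" where
  "interval x y = {z. dist x y = dist x z + dist z y}"

class median_space = metric_space +
  assumes ex1_median: "\<exists>!m. m \<in> interval x y \<inter> interval y z \<inter> interval z x"

definition med :: "'a::median_space \<Rightarrow> 'a \<Rightarrow> 'a \<Rightarrow> 'a" where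
  "med x y z = (THE m. m \<in> interval x y \<inter> interval y z \<inter> interval z x)"

definition med_convex :: "'a::median_space set \<Rightarrow> bool" where
  "med_convex C \<longleftrightarrow> (\<forall>x\<in>C. \<forall>y\<in>C. interval x y \<subseteq> C)"

definition median_algebra :: "'m set \<Rightarrow> ('m \<Rightarrow> 'm \<Rightarrow> 'm \<Rightarrow> 'm) \<Rightarrow> bool" where
  "median_algebra A m \<longleftrightarrow>
     (\<forall>a\<in>A. \<forall>b\<in>A. \<forall>c\<in>A. m a b c \<in> A) \<and>
     (\<forall>a\<in>A. \<forall>b\<in>A. m a a b = a) \<and>
     (\<forall>a\<in>A. \<forall>b\<in>A. \<forall>c\<in>A. m a b c = m b a c \<and> m a b c = m b c a) \<and>
     (\<forall>a\<in>A. \<forall>b\<in>A. \<forall>c\<in>A. \<forall>x\<in>A. m (m a x b) x c = m a x (m b x c))"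

definition median_hom ::
  "'m set \<Rightarrow> ('m \<Rightarrow> 'm \<Rightarrow> 'm \<Rightarrow> 'm) \<Rightarrow> 'n set \<Rightarrow> ('n \<Rightarrow> 'n \<Rightarrow> 'n \<Rightarrow> 'n) \<Rightarrow> ('m \<Rightarrow> 'n) \<Rightarrow> bool" where
  "median_hom A m B n f \<longleftrightarrow>
     median_algebra A m \<and> median_algebra B n \<and> f \<in> A \<rightarrow> B \<and>
     (\<forall>x\<in>A. \<forall>y\<in>A. \<forall>z\<in>A. f (m x y z) = n (f x) (f y) (f z))"

definition median_mono ::
  "'m set \<Rightarrow> ('m \<Rightarrow> 'm \<Rightarrow> 'm \<Rightarrow> 'm) \<Rightarrow> 'n set \<Rightarrow> ('n \<Rightarrow> 'n \<Rightarrow> 'n \<Rightarrow> 'n) \<Rightarrow> ('m \<Rightarrow> 'n) \<Rightarrow> bool" where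
  "median_mono A m B n f \<longleftrightarrow> median_hom A m B n f \<and> inj_on f A"

definition median_iso ::
  "'m set \<Rightarrow> ('m \<Rightarrow> 'm \<Rightarrow> 'm \<Rightarrow> 'm) \<Rightarrow> 'n set \<Rightarrow> ('n \<Rightarrow> 'n \<Rightarrow> 'n \<Rightarrow> 'n) \<Rightarrow> ('m \<Rightarrow> 'n) \<Rightarrow> bool" where
  "median_iso A m B n f \<longleftrightarrow> median_hom A m B n f \<and> bij_betw f A B"


section \<open>Halfspaces and ultrafilters\<close>

definition halfspaces :: "'a::median_space set set" where
  "halfspaces = {h. h \<noteq> {} \<and> med_convex h \<and> - h \<noteq> {} \<and> med_convex (- h)}"

definition hs_ultrafilter :: "'a::median_space set set \<Rightarrow> bool" where
  "hs_ultrafilter \<sigma> \<longleftrightarrow>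
     \<sigma> \<subseteq> halfspaces \<and> (\<forall>h\<in>\<sigma>. \<forall>k\<in>\<sigma>. h \<inter> k \<noteq> {}) \<and> (\<forall>h\<in>halfspaces. h \<in> \<sigma> \<or> - h \<in> \<sigma>)"

definition sigma_point :: "'a::median_space \<Rightarrow> 'a set set" where
  "sigma_point x = {h \<in> halfspaces. x \<in> h}"


section \<open>The Roller compactification\<close>

definition intervals :: "'a::median_space set set" where
  "intervals = {I. \<exists>x y. I = interval x y}"

text \<open>The projection to \<open>I = interval x y\<close> sends \<open>z\<close> to \<open>med x y z\<close>. This point depends on the set
  \<open>I\<close> only, and not on its endpoints: it is the gate of \<open>z\<close> in \<open>I\<close>.\<close>

definition iproj :: "'a::median_space set \<Rightarrow> 'a \<Rightarrow> 'a" where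
  "iproj I z = (THE p. \<exists>x y. I = interval x y \<and> p = med x y z)"

definition roller :: "('a::median_space set \<Rightarrow> 'a) set" where
  "roller = {\<xi> \<in> (\<Pi>\<^sub>E I\<in>intervals. I).
     \<forall>I\<in>intervals. \<forall>J\<in>intervals. I \<inter> J \<noteq> {} \<longrightarrow> iproj (I \<inter> J) (\<xi> I) = iproj (I \<inter> J) (\<xi> J)}"

definition roller_med ::
  "('a::median_space set \<Rightarrow> 'a) \<Rightarrow> ('a set \<Rightarrow> 'a) \<Rightarrow> ('a set \<Rightarrow> 'a) \<Rightarrow> ('a set \<Rightarrow> 'a)" where
  "roller_med \<xi> \<eta> \<zeta> = (\<lambda>I\<in>intervals. med (\<xi> I) (\<eta> I) (\<zeta> I))"

definition roller_embed :: "'a::median_space \<Rightarrow> ('a set \<Rightarrow> 'a)" where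
  "roller_embed x = (\<lambda>I\<in>intervals. iproj I x)"

definition sigma_roller :: "('a::median_space set \<Rightarrow> 'a) \<Rightarrow> 'a set set" where
  "sigma_roller \<xi> =
     {h \<in> halfspaces. \<exists>I\<in>intervals. I \<inter> h \<noteq> {} \<and> I \<inter> - h \<noteq> {} \<and> \<xi> I \<in> h}"


section \<open>The measure on halfspaces\<close>

definition hs_between :: "'a::median_space \<Rightarrow> 'a \<Rightarrow> 'a set set" where
  "hs_between x y = {h \<in> halfspaces. x \<notin> h \<and> y \<in> h}"

text \<open>Covers are indexed by all of \<open>\<nat>\<close>; a finite cover is padded with \<open>hs_between x x = {}\<close>, at no
  cost since \<open>dist x x = 0\<close>. The infimum of the empty set is \<open>\<infinity>\<close>.\<close>

definition hs_outer :: "'a::median_space set set \<Rightarrow> ennreal" where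
  "hs_outer E = Inf {(\<Sum>n. ennreal (dist (x n) (y n))) | x y :: nat \<Rightarrow> 'a.
     E \<subseteq> (\<Union>n. hs_between (x n) (y n))}"

definition hs_measure :: "'a::median_space set measure" where
  "hs_measure = measure_of halfspaces {H. \<exists>x y. H = hs_between x y} hs_outer"

definition morally_measurable :: "'a::median_space set set \<Rightarrow> bool" where
  "morally_measurable E \<longleftrightarrow>
     E \<subseteq> halfspaces \<and> (\<forall>x y. E \<inter> hs_between x y \<in> sets (completion hs_measure))"

definition nu_hat :: "'a::median_space set set \<Rightarrow> ennreal" where
  "nu_hat E = (SUP F \<in> {F. F \<subseteq> {H. \<exists>x y. H = hs_between x y} \<and> pairwise disjnt F}.
     \<Sum>\<^sub>\<infinity>H\<in>F. emeasure (completion hs_measure) (E \<inter> H))"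


section \<open>The median algebra of morally measurable ultrafilters\<close>

definition mm_ultrafilters :: "'a::median_space set set set" where
  "mm_ultrafilters = {\<sigma>. hs_ultrafilter \<sigma> \<and> morally_measurable \<sigma>}"

definition mm_rel :: "('a::median_space set set \<times> 'a set set) set" where
  "mm_rel = {(\<sigma>, \<tau>). \<sigma> \<in> mm_ultrafilters \<and> \<tau> \<in> mm_ultrafilters \<and> nu_hat ((\<sigma> - \<tau>) \<union> (\<tau> - \<sigma>)) = 0}"

definition mm_class :: "'a::median_space set set \<Rightarrow> 'a set set set" where
  "mm_class \<sigma> = mm_rel `` {\<sigma>}"

definition Mbar :: "'a::median_space set set set set" where
  "Mbar = mm_ultrafilters // mm_rel"

definition majority :: "'b set \<Rightarrow> 'b set \<Rightarrow> 'b set \<Rightarrow> 'b set" where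
  "majority A B C = (A \<inter> B) \<union> (B \<inter> C) \<union> (C \<inter> A)"

text \<open>The usual lifting of an operation to a quotient: all representatives give the same class, which
  is therefore the union.\<close>

definition Mbar_med ::
  "'a::median_space set set set \<Rightarrow> 'a set set set \<Rightarrow> 'a set set set \<Rightarrow> 'a set set set" where
  "Mbar_med P Q R = (\<Union>\<sigma>\<in>P. \<Union>\<tau>\<in>Q. \<Union>\<rho>\<in>R. mm_class (majority \<sigma> \<tau> \<rho>))"

end

theory Submission
  imports Defs
begin

text \<open>Intervals of a median space have gates, and points are separated by halfspaces, so medians and
  intervals can be computed halfspace by halfspace. The set \<open>hs_between x y\<close> is compact in
  \<open>2\<^sup>X\<close>; hence \<open>hs_outer (hs_between x y) = dist x y\<close>, and a measurable subset of it is
  approximated from inside by compact sets \<open>K\<close>. If \<open>\<sigma>\<close> is an ultrafilter,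
  \<open>\<sigma> \<inter> hs_between x y\<close> is closed under passing to larger halfspaces, so it contains with \<open>K\<close> the
  upward closure of \<open>K\<close>, which by Priestley separation is an intersection of sets
  \<open>hs_between x p\<close> with \<open>p \<in> interval x y\<close>. By completeness the infimum of these \<open>p\<close> exists, and
  \<open>hs_between x (inf p)\<close> agrees with the upward closure up to a null set. The supremum
  \<open>s\<close> over all \<open>K\<close> then satisfies \<open>\<sigma> \<inter> hs_between x y = hs_between x s\<close> up to a null set. These points \<open>s\<close>
  are unique and hence coherent, so they form the point of the Roller compactification representing \<open>\<sigma>\<close>.\<close>

section \<open>Intervals of a median space\<close>

lemma interval_iff: "z \<in> interval x y \<longleftrightarrow> dist x y = dist x z + dist z y"
  for x :: "'a::metric_space"
  by (simp add: interval_def)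

lemma interval_commute: "interval x y = interval y x"
  for x :: "'a::metric_space"
  by (auto simp: interval_iff dist_commute add.commute)

lemma endpoints_in_interval [simp]: "x \<in> interval x y" "y \<in> interval x y"
  for x :: "'a::metric_space"
  by (auto simp: interval_iff)

lemma interval_refl [simp]: "interval x x = {x}"
  for x :: "'a::metric_space"
  by (auto simp: interval_iff dist_commute)

text \<open>Adding the two equations gives d(x,y) = d(x,w) + d(w,z) + d(z,y), so the triangle
  inequalities for \<open>x, w, y\<close> and for \<open>w, z, y\<close> are equalities.\<close>

lemma interval_nest:
  fixes x :: "'a::metric_space"
  assumes "z \<in> interval x y" "w \<in> interval x z"
  shows "w \<in> interval x y" "z \<in> interval w y"
  using assms dist_triangle[of x y w] dist_triangle[of w y z]
  by (auto simp: interval_iff)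

lemma interval_antisym:
  fixes x :: "'a::metric_space"
  assumes "z \<in> interval x y" "y \<in> interval x z"
  shows "y = z"
proof -
  have "dist y z + dist z y = 0" using assms by (simp add: interval_iff)
  then show ?thesis by (simp add: dist_commute)
qed

lemma med_in:
  fixes x :: "'a::median_space"
  shows "med x y z \<in> interval x y" "med x y z \<in> interval y z" "med x y z \<in> interval z x"
proof -
  have "med x y z \<in> interval x y \<inter> interval y z \<inter> interval z x"
    unfolding med_def by (rule theI'[OF ex1_median])
  then show "med x y z \<in> interval x y" "med x y z \<in> interval y z" "med x y z \<in> interval z x"
    by auto
qed

lemma med_unique:
  fixes x :: "'a::median_space"
  assumes "m \<in> interval x y" "m \<in> interval y z" "m \<in> interval z x"
  shows "med x y z = m"
  using ex1_median[of x y z] assms med_in[of x y z] by blast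

lemma med_in_interval [simp]:
  fixes x :: "'a::median_space"
  shows "med x y z \<in> interval x y" "med x y z \<in> interval y x" "med x y z \<in> interval y z"
    "med x y z \<in> interval z y" "med x y z \<in> interval x z" "med x y z \<in> interval z x"
  using med_in[of x y z] by (auto simp: interval_commute)

text \<open>With \<open>a = med t r p\<close> and \<open>c = med t s p\<close>, the point \<open>med t a c\<close> is also a median of
  \<open>t, r, s\<close>.\<close>

lemma med_gate:
  fixes t :: "'a::median_space"
  assumes p: "p \<in> interval r s"
  shows "med t r s \<in> interval t p"
proof -
  define a c where "a = med t r p" and "c = med t s p"
  define v where "v = med t a c"
  have a: "a \<in> interval t r" "a \<in> interval r p" "a \<in> interval t p"
    and c: "c \<in> interval t s" "c \<in> interval p s" "c \<in> interval t p"
    and v: "v \<in> interval t a" "v \<in> interval t c" "v \<in> interval a c"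
    unfolding a_def c_def v_def by (rule med_in_interval)+
  have prc: "p \<in> interval r c" and crs: "c \<in> interval r s"
    using interval_nest[of p s r c] p c(2) by (simp_all add: interval_commute)
  have "a \<in> interval r c"
    by (rule interval_nest(1)[OF prc a(2)])
  have "v \<in> interval r c"
    using interval_nest(1)[of a c r v] \<open>a \<in> interval r c\<close> v(3) by (simp add: interval_commute)
  then have vrs: "v \<in> interval r s" by (rule interval_nest(1)[OF crs])
  have "v \<in> interval t r" "v \<in> interval t s"
    using interval_nest(1)[OF a(1) v(1)] interval_nest(1)[OF c(1) v(2)] by auto
  then have "med t r s = v"
    using vrs by (intro med_unique) (auto simp: interval_commute)
  moreover have "v \<in> interval t p" using interval_nest(1)[OF a(3) v(1)] .
  ultimately show ?thesis by simp
qed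

text \<open>By \<open>med_gate\<close>, the gate \<open>v\<close> of \<open>t\<close> lies between
  \<open>t\<close> and \<open>p\<close> and between \<open>t\<close> and \<open>q\<close>. As
  \<open>t\<close> is between \<open>p\<close> and \<open>q\<close>, the path from \<open>p\<close>
  to \<open>q\<close> through \<open>v\<close> would be shorter than d(p,q) by 2 d(t,v), so
  \<open>t = v\<close>.\<close>

lemma interval_convex:
  fixes r :: "'a::median_space"
  assumes p: "p \<in> interval r s" and q: "q \<in> interval r s" and t: "t \<in> interval p q"
  shows "t \<in> interval r s"
proof -
  define v where "v = med t r s"
  have "v \<in> interval t p" "v \<in> interval t q"
    using med_gate[OF p] med_gate[OF q] by (auto simp: v_def)
  then have "dist t v = 0"
    using t dist_triangle[of p q v] dist_commute[of v p] dist_commute[of t p] zero_le_dist[of t v]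
    unfolding interval_iff by linarith
  then show ?thesis using med_in_interval(3)[of t r s] by (simp add: v_def)
qed

text \<open>Replacing \<open>e\<close> by \<open>x\<close> does not change the median with
  \<open>u\<close> and \<open>v\<close>, because \<open>x\<close> lies between \<open>e\<close> and
  each of them; so \<open>x\<close> comes before this median on the way from
  \<open>e\<close>.\<close>

lemma interval_Int_shadow:
  fixes u :: "'a::median_space"
  assumes "x \<in> interval e u" "x \<in> interval e v"
  shows "x \<in> interval e (med e u v)"
proof -
  have *: "med x u v \<in> interval x u" "med x u v \<in> interval x v" "med x u v \<in> interval u v"
    by simp_all
  have g: "med x u v \<in> interval e u" "med x u v \<in> interval e v" "x \<in> interval e (med x u v)"
    using interval_nest[of x u e "med x u v"] interval_nest[of x v e "med x u v"] assms *
    by (simp_all add: interval_commute)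
  have "med e u v = med x u v"
    using g * by (intro med_unique) (auto simp: interval_commute)
  then show ?thesis using g by simp
qed

text \<open>The points hidden behind \<open>x\<close> when seen from \<open>e\<close> form a convex
  set. By \<open>med_gate\<close>, the median of \<open>e, u, v\<close> lies between
  \<open>e\<close> and \<open>w\<close>, and \<open>x\<close> lies between \<open>e\<close> and this
  median.\<close>

lemma shadow_convex:
  fixes u :: "'a::median_space"
  assumes "x \<in> interval e u" "x \<in> interval e v" "w \<in> interval u v"
  shows "x \<in> interval e w"
  using interval_nest(1)[OF med_gate[OF assms(3)] interval_Int_shadow[OF assms(1,2)]] .


section \<open>Separation by halfspaces\<close>

lemma med_convexD: "med_convex C \<Longrightarrow> x \<in> C \<Longrightarrow> y \<in> C \<Longrightarrow> z \<in> interval x y \<Longrightarrow> z \<in> C"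
  by (auto simp: med_convex_def)

lemma med_convex_join:
  fixes M :: "'a::median_space set"
  assumes M: "med_convex M"
  shows "med_convex (\<Union>c\<in>M. interval c u)"
  unfolding med_convex_def
proof (intro ballI subsetI)
  fix a b z
  assume "a \<in> (\<Union>c\<in>M. interval c u)" "b \<in> (\<Union>c\<in>M. interval c u)" and z: "z \<in> interval a b"
  then obtain c c' where c: "c \<in> M" "a \<in> interval c u" "c' \<in> M" "b \<in> interval c' u" by blast
  define d where "d = med c c' z"
  define e where "e = med u z d"
  have d: "d \<in> M" "d \<in> interval z c" "d \<in> interval z c'"
    using med_convexD[OF M c(1,3)] by (auto simp: d_def)
  have e: "e \<in> interval z u" "e \<in> interval z d" "e \<in> interval u d" by (auto simp: e_def)
  have "e \<in> interval z c" "e \<in> interval z c'"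
    using interval_nest(1) d e by blast+
  \<comment> \<open>The shadow of \<open>e\<close> seen from \<open>z\<close> contains
    \<open>c\<close>, \<open>c'\<close> and \<open>u\<close>. By convexity it contains
    \<open>a\<close> and \<open>b\<close>, then \<open>z\<close> itself, which forces
    \<open>e = z\<close>; thus \<open>z\<close> lies between \<open>u\<close> and the point
    \<open>d\<close> of \<open>M\<close>.\<close>
  then have "e \<in> interval z a" "e \<in> interval z b"
    using shadow_convex[OF _ e(1) c(2)] shadow_convex[OF _ e(1) c(4)] by auto
  then have "e \<in> interval z z" using shadow_convex z by blast
  then show "z \<in> (\<Union>c\<in>M. interval c u)" using e(3) d(1) by (auto simp: interval_commute)
qed

text \<open>A Pasch-type property. The point \<open>e\<close> lies between \<open>x\<close> and each
  of \<open>c\<close>, \<open>c'\<close> and \<open>w\<close>. Hence \<open>x\<close> hides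
  \<open>u\<close> and \<open>v\<close> from \<open>e\<close>, and so it hides \<open>w\<close>;
  being also between \<open>x\<close> and \<open>w\<close>, the point \<open>e\<close> equals
  \<open>x\<close>.\<close>

lemma interval_Peano:
  fixes x :: "'a::median_space"
  assumes "x \<in> interval c u" "x \<in> interval c' v" "w \<in> interval u v"
  shows "x \<in> interval c (med c' w x)"
proof -
  define t where "t = med c' w x"
  define e where "e = med c x t"
  have t: "t \<in> interval x c'" "t \<in> interval x w" by (auto simp: t_def)
  have e: "e \<in> interval x c" "e \<in> interval x t" "e \<in> interval c t" by (auto simp: e_def)
  have "e \<in> interval x c'" "e \<in> interval x w"
    using interval_nest(1) t e by blast+
  then have "x \<in> interval e u" "x \<in> interval e v"
    using interval_nest(2)[of x c u e] interval_nest(2)[of x c' v e] assms(1,2) e(1)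
      \<open>e \<in> interval x c'\<close> by (simp_all add: interval_commute)
  then have "x \<in> interval e w" using shadow_convex assms(3) by blast
  then have "x = e"
    using \<open>e \<in> interval x w\<close> interval_antisym[of e w x] by (simp add: interval_commute)
  then show ?thesis using e(3) by (simp add: t_def)
qed

text \<open>The Kakutani argument: Zorn's lemma gives a maximal convex set \<open>M\<close>
  containing \<open>y\<close> and avoiding \<open>x\<close>, and maximality makes its complement
  convex.\<close>

lemma ex_halfspace:
  fixes x :: "'a::median_space"
  assumes "x \<noteq> y"
  shows "\<exists>h\<in>halfspaces. x \<notin> h \<and> y \<in> h"
proof -
  define \<A> where "\<A> = {C. med_convex C \<and> y \<in> C \<and> x \<notin> C}"
  have "\<exists>M\<in>\<A>. \<forall>C\<in>\<A>. M \<subseteq> C \<longrightarrow> C = M"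
  proof (rule subset_Zorn_nonempty)
    have "{y} \<in> \<A>" using assms by (simp add: \<A>_def med_convex_def)
    then show "\<A> \<noteq> {}" by blast
    fix \<C> assume ne: "\<C> \<noteq> {}" and ch: "subset.chain \<A> \<C>"
    have "med_convex (\<Union>\<C>)"
      unfolding med_convex_def
    proof (intro ballI)
      fix a b assume "a \<in> \<Union>\<C>" "b \<in> \<Union>\<C>"
      then obtain A B where AB: "A \<in> \<C>" "B \<in> \<C>" "a \<in> A" "b \<in> B" by blast
      then have "A \<subseteq> B \<or> B \<subseteq> A" using ch by (simp add: subset_chain_def)
      then obtain C where C: "C \<in> \<C>" "a \<in> C" "b \<in> C" using AB by blast
      then have "med_convex C" using ch by (auto simp: subset_chain_def \<A>_def)
      then have "interval a b \<subseteq> C" using C by (simp add: med_convex_def)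
      then show "interval a b \<subseteq> \<Union>\<C>" using C by blast
    qed
    then show "\<Union>\<C> \<in> \<A>" using ne ch by (auto simp: subset_chain_def \<A>_def)
  qed
  then obtain M where "M \<in> \<A>" and max: "\<And>C. C \<in> \<A> \<Longrightarrow> M \<subseteq> C \<Longrightarrow> C = M" by blast
  then have M: "med_convex M" "y \<in> M" "x \<notin> M" by (auto simp: \<A>_def)
  \<comment> \<open>Otherwise the join of \<open>M\<close> with \<open>u\<close> would be a strictly
    larger convex set that still avoids \<open>x\<close>.\<close>
  have join: "\<exists>c\<in>M. x \<in> interval c u" if "u \<notin> M" for u
  proof (rule ccontr)
    assume "\<not> ?thesis"
    then have "(\<Union>c\<in>M. interval c u) \<in> \<A>"
      using med_convex_join[OF M(1)] M(2) by (auto simp: \<A>_def intro: bexI[of _ y])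
    moreover have "M \<subseteq> (\<Union>c\<in>M. interval c u)" by auto
    ultimately have "(\<Union>c\<in>M. interval c u) = M" by (rule max)
    moreover have "u \<in> (\<Union>c\<in>M. interval c u)" using M(2) by auto
    ultimately show False using that by simp
  qed
  have "med_convex (- M)"
    unfolding med_convex_def
  proof (intro ballI subsetI ComplI)
    fix u v w assume "u \<in> - M" "v \<in> - M" and w: "w \<in> interval u v" "w \<in> M"
    then obtain c c' where c: "c \<in> M" "x \<in> interval c u" "c' \<in> M" "x \<in> interval c' v"
      using join[of u] join[of v] by auto
    \<comment> \<open>By \<open>interval_Peano\<close>, \<open>x\<close> lies between
      \<open>c\<close> and this point, so convexity of \<open>M\<close> would put \<open>x\<close>
      into \<open>M\<close>.\<close>
    have "med c' w x \<in> M" using med_convexD[OF M(1) c(3) w(2)] by simp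
    then have "x \<in> M"
      using med_convexD[OF M(1) c(1)] interval_Peano[OF c(2,4) w(1)] by blast
    then show False using M(3) by simp
  qed
  then have "M \<in> halfspaces" using M by (auto simp: halfspaces_def)
  then show ?thesis using M by blast
qed

lemma halfspaces_Compl [simp]: "- h \<in> halfspaces \<longleftrightarrow> h \<in> halfspaces"
  by (auto simp: halfspaces_def)

text \<open>Medians, intervals and equality can be tested on each halfspace separately, which turns
  identities between them into propositional tautologies.\<close>

lemma med_in_halfspace:
  fixes x :: "'a::median_space"
  assumes "h \<in> halfspaces"
  shows "med x y z \<in> h \<longleftrightarrow> (x \<in> h \<and> y \<in> h) \<or> (y \<in> h \<and> z \<in> h) \<or> (z \<in> h \<and> x \<in> h)"
proof -
  have *: "med x y z \<in> C"
    if "med_convex C" "(x \<in> C \<and> y \<in> C) \<or> (y \<in> C \<and> z \<in> C) \<or> (z \<in> C \<and> x \<in> C)" for C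
    using that(2) med_convexD[OF that(1) _ _ med_in_interval(1)]
      med_convexD[OF that(1) _ _ med_in_interval(3)] med_convexD[OF that(1) _ _ med_in_interval(6)]
    by metis
  have "med_convex h" "med_convex (- h)" using assms by (auto simp: halfspaces_def)
  from *[OF this(1)] *[OF this(2)] show ?thesis by auto
qed

lemma eq_iff_halfspaces:
  fixes x :: "'a::median_space"
  shows "x = y \<longleftrightarrow> (\<forall>h\<in>halfspaces. x \<in> h \<longleftrightarrow> y \<in> h)"
  using ex_halfspace[of x y] by auto

lemma interval_iff_halfspaces:
  fixes x :: "'a::median_space"
  shows "z \<in> interval x y \<longleftrightarrow>
    (\<forall>h\<in>halfspaces. (x \<in> h \<and> y \<in> h \<longrightarrow> z \<in> h) \<and> (x \<notin> h \<and> y \<notin> h \<longrightarrow> z \<notin> h))"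
proof
  assume "z \<in> interval x y"
  then have "med x y z = z"
    by (intro med_unique) (simp_all add: interval_commute)
  then show "\<forall>h\<in>halfspaces. (x \<in> h \<and> y \<in> h \<longrightarrow> z \<in> h) \<and> (x \<notin> h \<and> y \<notin> h \<longrightarrow> z \<notin> h)"
    using med_in_halfspace[of _ x y z] by auto
next
  assume "\<forall>h\<in>halfspaces. (x \<in> h \<and> y \<in> h \<longrightarrow> z \<in> h) \<and> (x \<notin> h \<and> y \<notin> h \<longrightarrow> z \<notin> h)"
  then have "med x y z = z"
    by (subst eq_iff_halfspaces) (simp add: med_in_halfspace, blast)
  then show "z \<in> interval x y" by (metis med_in_interval(1))
qed

lemma in_intervalI:
  fixes x :: "'a::median_space"
  assumes "\<And>h. h \<in> halfspaces \<Longrightarrow> (x \<in> h \<and> y \<in> h \<longrightarrow> z \<in> h) \<and> (x \<notin> h \<and> y \<notin> h \<longrightarrow> z \<notin> h)"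
  shows "z \<in> interval x y"
  unfolding interval_iff_halfspaces using assms by blast

lemma in_intervalD:
  fixes x :: "'a::median_space"
  assumes "z \<in> interval x y" "h \<in> halfspaces"
  shows "(x \<in> h \<and> y \<in> h \<longrightarrow> z \<in> h) \<and> (x \<notin> h \<and> y \<notin> h \<longrightarrow> z \<notin> h)"
  using assms unfolding interval_iff_halfspaces by blast

lemma eq_by_halfspaces:
  fixes x :: "'a::median_space"
  assumes "\<And>h. h \<in> halfspaces \<Longrightarrow> x \<in> h \<longleftrightarrow> y \<in> h"
  shows "x = y"
  using assms eq_iff_halfspaces by blast


section \<open>Distances and halfspace-intervals\<close>

lemma hs_between_subset: "hs_between x y \<subseteq> halfspaces"
  by (auto simp: hs_between_def)

lemma hs_between_refl [simp]: "hs_between x x = {}"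
  by (auto simp: hs_between_def)

text \<open>Each of the diagonals d(p,q') and d(q,p') is a sum of two adjacent sides in two ways;
  comparing the sums shows that opposite sides are equal.\<close>

lemma dist_rectangle:
  fixes p :: "'a::metric_space"
  assumes "q \<in> interval p q'" "q' \<in> interval q p'" "p' \<in> interval p q'" "p \<in> interval q p'"
  shows "dist p q = dist p' q'"
  using assms by (simp add: interval_iff dist_commute)

text \<open>Projecting \<open>p\<close> and \<open>q\<close> to \<open>interval u v\<close> loses
  none of the halfspaces between them. The four points therefore span a rectangle, and the
  projections follow each other on the way from \<open>u\<close> to \<open>v\<close>.\<close>

lemma dist_mono_hs_between:
  fixes p :: "'a::median_space"
  assumes S: "hs_between p q \<subseteq> hs_between u v"
  shows "dist p q \<le> dist u v"
proof -
  define p' q' where "p' = med u v p" and "q' = med u v q"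
  have S1: "u \<notin> h \<and> v \<in> h" if "h \<in> halfspaces" "p \<notin> h" "q \<in> h" for h
    using S that by (auto simp: hs_between_def)
  \<comment> \<open>A halfspace containing \<open>p\<close> but not \<open>q\<close> is handled
    through its complement.\<close>
  have S: "(p \<notin> h \<and> q \<in> h \<longrightarrow> u \<notin> h \<and> v \<in> h) \<and> (p \<in> h \<and> q \<notin> h \<longrightarrow> u \<in> h \<and> v \<notin> h) \<and>
      (p' \<in> h \<longleftrightarrow> (u \<in> h \<and> v \<in> h) \<or> (v \<in> h \<and> p \<in> h) \<or> (p \<in> h \<and> u \<in> h)) \<and>
      (q' \<in> h \<longleftrightarrow> (u \<in> h \<and> v \<in> h) \<or> (v \<in> h \<and> q \<in> h) \<or> (q \<in> h \<and> u \<in> h))"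
    if "h \<in> halfspaces" for h
    using S1[of h] S1[of "- h"] that by (simp add: p'_def q'_def med_in_halfspace)
  have *: "q \<in> interval p q'" "q' \<in> interval q p'" "p' \<in> interval p q'" "p \<in> interval q p'"
    "p' \<in> interval u v" "q' \<in> interval p' v"
    by (rule in_intervalI, drule S, argo)+
  from *(1-4) have "dist p q = dist p' q'" by (rule dist_rectangle)
  moreover from *(5,6) have "dist p' q' \<le> dist u v" by (simp add: interval_iff)
  ultimately show ?thesis by simp
qed

text \<open>The point \<open>w\<close> cuts the way from \<open>u\<close> to \<open>v\<close> in
  two. The halfspaces between the projections to \<open>interval x a\<close> lie between
  \<open>u\<close> and \<open>w\<close>, those between the projections to
  \<open>interval a y\<close> between \<open>w\<close> and \<open>v\<close>.\<close>

lemma dist_split_aux: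
  fixes u :: "'a::median_space"
  assumes a: "a \<in> interval x y" and u: "u \<in> interval x v"
  shows "dist (med x a u) (med x a v) + dist (med a y u) (med a y v) \<le> dist u v"
proof -
  define w where "w = med u v a"
  have "(med x a u \<notin> h \<and> med x a v \<in> h \<longrightarrow> u \<notin> h \<and> w \<in> h) \<and>
      (med a y u \<notin> h \<and> med a y v \<in> h \<longrightarrow> w \<notin> h \<and> v \<in> h)"
    if h: "h \<in> halfspaces" for h
    unfolding w_def med_in_halfspace[OF h] using in_intervalD[OF a h] in_intervalD[OF u h] by argo
  then have "hs_between (med x a u) (med x a v) \<subseteq> hs_between u w"
    "hs_between (med a y u) (med a y v) \<subseteq> hs_between w v"
    unfolding hs_between_def by blast+
  then have "dist (med x a u) (med x a v) \<le> dist u w" "dist (med a y u) (med a y v) \<le> dist w v"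
    by (simp_all add: dist_mono_hs_between)
  moreover have "w \<in> interval u v" by (simp add: w_def)
  ultimately show ?thesis by (simp add: interval_iff)
qed

text \<open>Passing through \<open>med x u v\<close>, it suffices to treat the case where \<open>x\<close> does not separate \<open>u\<close>
  from \<open>v\<close>.\<close>

lemma dist_split:
  fixes u :: "'a::median_space"
  assumes a: "a \<in> interval x y"
  shows "dist (med x a u) (med x a v) + dist (med a y u) (med a y v) \<le> dist u v"
proof -
  define w where "w = med x u v"
  have "w \<in> interval x u" "w \<in> interval x v" "w \<in> interval u v" by (simp_all add: w_def)
  then show ?thesis
    using dist_split_aux[OF a, of w u] dist_split_aux[OF a, of w v]
      dist_triangle[of "med x a u" "med x a v" "med x a w"]
      dist_triangle[of "med a y u" "med a y v" "med a y w"]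
    by (simp add: interval_iff dist_commute)
qed

section \<open>Cutting one halfspace-interval by another, and finite subadditivity\<close>

definition cut_hi :: "'a::median_space \<Rightarrow> 'a \<Rightarrow> 'a \<Rightarrow> 'a" where
  "cut_hi x y v = med x y v"

text \<open>Projecting \<open>u\<close> to the interval from \<open>x\<close> to
  \<open>cut_hi x y v\<close>, and not to all of \<open>interval x y\<close>, ensures the order
  \<open>x\<close>, \<open>cut_lo\<close>, \<open>cut_hi\<close>, \<open>y\<close>. The halfspaces
  between the two middle points are those of \<open>hs_between x y\<close> that lie in
  \<open>hs_between u v\<close>.\<close>

definition cut_lo :: "'a::median_space \<Rightarrow> 'a \<Rightarrow> 'a \<Rightarrow> 'a \<Rightarrow> 'a" where
  "cut_lo x y u v = med x (cut_hi x y v) u"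

lemma cut_in_interval:
  "cut_hi x y v \<in> interval x y" "cut_lo x y u v \<in> interval x (cut_hi x y v)"
  by (simp_all add: cut_hi_def cut_lo_def)

lemma dist_cut:
  "dist x y = dist x (cut_lo x y u v) + dist (cut_lo x y u v) (cut_hi x y v) + dist (cut_hi x y v) y"
  using cut_in_interval(1)[where x=x and y=y and v=v]
    cut_in_interval(2)[where x=x and y=y and u=u and v=v]
  by (simp add: interval_iff)

lemma hs_between_cut:
  "hs_between x y \<inter> hs_between u v = hs_between (cut_lo x y u v) (cut_hi x y v)"
  "hs_between x y - hs_between u v = hs_between x (cut_lo x y u v) \<union> hs_between (cut_hi x y v) y"
  by (auto simp: hs_between_def cut_hi_def cut_lo_def med_in_halfspace)

text \<open>Induction on the number of covering sets. Removing the last one leaves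
  \<open>hs_between x a\<close> and \<open>hs_between b y\<close>. Each is covered by the other sets
  after projecting their endpoints, and the two projections of a covering set have total length at
  most its own by \<open>dist_split\<close>.\<close>

lemma dist_le_finite_cover:
  fixes u v :: "nat \<Rightarrow> 'a::median_space"
  assumes "hs_between x y \<subseteq> (\<Union>i<N. hs_between (u i) (v i))"
  shows "dist x y \<le> (\<Sum>i<N. dist (u i) (v i))"
  using assms
proof (induction N arbitrary: x y u v)
  case 0
  then have "x = y" using ex_halfspace[of x y] by (auto simp: hs_between_def)
  then show ?case by simp
next
  case (Suc N)
  define a b where "a = cut_lo x y (u N) (v N)" and "b = cut_hi x y (v N)"
  have ab: "b \<in> interval x y" "a \<in> interval x b"
    using cut_in_interval by (simp_all add: a_def b_def)
  then have aby: "b \<in> interval a y" "a \<in> interval x y" using interval_nest by blast+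
  have restrict: "hs_between p q \<subseteq> (\<Union>i<N. hs_between (med p q (u i)) (med p q (v i)))"
    if "hs_between p q \<subseteq> hs_between x y - hs_between (u N) (v N)" for p q
  proof
    fix h assume h: "h \<in> hs_between p q"
    then have "h \<in> (\<Union>i<Suc N. hs_between (u i) (v i)) - hs_between (u N) (v N)"
      using that Suc.prems by blast
    then obtain i where "i < N" "h \<in> hs_between (u i) (v i)"
      by (auto simp: less_Suc_eq)
    then show "h \<in> (\<Union>i<N. hs_between (med p q (u i)) (med p q (v i)))"
      using h by (auto simp: hs_between_def med_in_halfspace)
  qed
  have sub: "hs_between x a \<subseteq> hs_between x y - hs_between (u N) (v N)"
    "hs_between b y \<subseteq> hs_between x y - hs_between (u N) (v N)"
    using hs_between_cut(2)[of x y "u N" "v N"] by (auto simp: a_def b_def)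
  have xa: "dist x a \<le> (\<Sum>i<N. dist (med x a (u i)) (med x a (v i)))"
    by (rule Suc.IH[OF restrict[OF sub(1)]])
  have yb: "dist b y \<le> (\<Sum>i<N. dist (med b y (u i)) (med b y (v i)))"
    by (rule Suc.IH[OF restrict[OF sub(2)]])
  \<comment> \<open>The point \<open>a\<close> comes before \<open>b\<close>, so projecting to
    \<open>interval b y\<close> is no longer than projecting to \<open>interval a y\<close>; then
    \<open>dist_split\<close> applies at the single point \<open>a\<close>.\<close>
  have le: "dist (med x a p) (med x a q) + dist (med b y p) (med b y q) \<le> dist p q" for p q
  proof -
    have "med b y p \<notin> h \<and> med b y q \<in> h \<longrightarrow> med a y p \<notin> h \<and> med a y q \<in> h"
      if h: "h \<in> halfspaces" for h
      unfolding med_in_halfspace[OF h] using in_intervalD[OF aby(1) h] by argo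
    then have "hs_between (med b y p) (med b y q) \<subseteq> hs_between (med a y p) (med a y q)"
      unfolding hs_between_def by blast
    then have "dist (med b y p) (med b y q) \<le> dist (med a y p) (med a y q)"
      by (rule dist_mono_hs_between)
    then show ?thesis using dist_split[OF aby(2), of p q] by simp
  qed
  have "dist a b \<le> dist (u N) (v N)"
    using hs_between_cut(1)[of x y "u N" "v N"]
    by (intro dist_mono_hs_between) (auto simp: a_def b_def)
  moreover have "dist x a + dist b y \<le> (\<Sum>i<N. dist (u i) (v i))"
    using xa yb sum_mono[of "{..<N}" "\<lambda>i. dist (med x a (u i)) (med x a (v i)) + dist (med b y (u i)) (med b y (v i))"
      "\<lambda>i. dist (u i) (v i)"] le
    by (simp add: sum.distrib)
  moreover have "dist x y = dist x a + dist a b + dist b y"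
    unfolding a_def b_def by (rule dist_cut)
  ultimately show ?case by simp
qed


section \<open>Compactness of halfspace-intervals\<close>

text \<open>In \<open>2\<^sup>X\<close> the set \<open>hs_between x y\<close> is closed, and \<open>hs_between (u i) (v i)\<close> is cut
  out of it by an open cylinder.\<close>

lemma hs_between_finite_subcover:
  fixes x :: "'a::median_space"
  assumes cover: "hs_between x y \<subseteq> (\<Union>i\<in>A. hs_between (u i) (v i))"
  obtains B where "finite B" "B \<subseteq> A" "hs_between x y \<subseteq> (\<Union>i\<in>B. hs_between (u i) (v i))"
proof -
  have c: "continuous_on UNIV (\<lambda>f::'a \<Rightarrow> bool. f a)" for a
    by (rule continuous_on_product_coordinates)
  have op: "open {f::'a \<Rightarrow> bool. f a}" "open {f::'a \<Rightarrow> bool. \<not> f a}" for a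
    using open_vimage[OF open_discrete[of "{True}"] c[of a]]
      open_vimage[OF open_discrete[of "{False}"] c[of a]] by (simp_all add: vimage_def)
  have "- {f::'a \<Rightarrow> bool. f a} = {f. \<not> f a}" for a by auto
  then have cl: "closed {f::'a \<Rightarrow> bool. f a}" "closed {f::'a \<Rightarrow> bool. \<not> f a}" for a
    using op[of a] unfolding closed_def by (simp_all add: Collect_neg_eq)
  \<comment> \<open>Halfspaces are encoded by their characteristic functions. Convexity of a set and
    of its complement is a family of conditions on three coordinates each; that both are nonempty
    follows from the values at \<open>x\<close> and \<open>y\<close>.\<close>
  define K where "K = (\<lambda>h a. a \<in> h) ` hs_between x y"
  have K: "K = {f. \<not> f x} \<inter> {f. f y} \<inter>
    (\<Inter>a. \<Inter>b. \<Inter>c\<in>interval a b. ({f. \<not> f a} \<union> {f. \<not> f b} \<union> {f. f c}) \<inter> ({f. f a} \<union> {f. f b} \<union> {f. \<not> f c}))"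
  proof (intro equalityI subsetI)
    fix f assume "f \<in> K"
    then obtain h where "h \<in> hs_between x y" "f = (\<lambda>a. a \<in> h)" by (auto simp: K_def)
    then show "f \<in> {f. \<not> f x} \<inter> {f. f y} \<inter>
      (\<Inter>a. \<Inter>b. \<Inter>c\<in>interval a b. ({f. \<not> f a} \<union> {f. \<not> f b} \<union> {f. f c}) \<inter> ({f. f a} \<union> {f. f b} \<union> {f. \<not> f c}))"
      by (auto simp: hs_between_def interval_iff_halfspaces)
  next
    fix f assume f: "f \<in> {f. \<not> f x} \<inter> {f. f y} \<inter>
      (\<Inter>a. \<Inter>b. \<Inter>c\<in>interval a b. ({f. \<not> f a} \<union> {f. \<not> f b} \<union> {f. f c}) \<inter> ({f. f a} \<union> {f. f b} \<union> {f. \<not> f c}))"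
    then have "Collect f \<in> hs_between x y"
      by (auto simp: hs_between_def halfspaces_def med_convex_def)
    then show "f \<in> K" unfolding K_def by (intro image_eqI) auto
  qed
  have "closed K"
    unfolding K by (intro closed_Int closed_INT ballI closed_Un cl)
  moreover have "compact (UNIV :: ('a \<Rightarrow> bool) set)"
  proof -
    have "compact_space (euclidean :: bool topology)"
      by (simp add: compact_space_def finite_imp_compact)
    then have "compact_space (product_topology (\<lambda>_::'a. euclidean :: bool topology) UNIV)"
      by (simp add: compact_space_product_topology)
    then show ?thesis by (simp add: euclidean_product_topology compact_space_def)
  qed
  ultimately have cK: "compact K" by (metis closed_Int_compact inf_top.right_neutral)
  have o: "open ({f. \<not> f (u i)} \<inter> {f. f (v i)})" if "i \<in> A" for i
    by (intro open_Int op)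
  have cov: "K \<subseteq> (\<Union>i\<in>A. {f. \<not> f (u i)} \<inter> {f. f (v i)})"
    using cover by (auto simp: K_def hs_between_def)
  obtain B where "B \<subseteq> A" "finite B" "K \<subseteq> (\<Union>i\<in>B. {f. \<not> f (u i)} \<inter> {f. f (v i)})"
    by (rule compactE_image[OF cK o cov])
  moreover from this have "hs_between x y \<subseteq> (\<Union>i\<in>B. hs_between (u i) (v i))"
    by (fastforce simp: K_def hs_between_def)
  ultimately show thesis using that by blast
qed

text \<open>Compactness replaces the countable cover by a finite one. This is what makes
  \<open>dist\<close> a premeasure.\<close>

lemma dist_le_cover:
  fixes u v :: "nat \<Rightarrow> 'a::median_space"
  assumes "hs_between x y \<subseteq> (\<Union>i. hs_between (u i) (v i))"
  shows "ennreal (dist x y) \<le> (\<Sum>i. ennreal (dist (u i) (v i)))"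
proof -
  obtain B where "finite B" and B: "hs_between x y \<subseteq> (\<Union>i\<in>B. hs_between (u i) (v i))"
    using assms by (rule hs_between_finite_subcover)
  then obtain N where "B \<subseteq> {..<N}" using finite_nat_iff_bounded by blast
  then have "hs_between x y \<subseteq> (\<Union>i<N. hs_between (u i) (v i))" using B by blast
  then have "dist x y \<le> (\<Sum>i<N. dist (u i) (v i))" by (rule dist_le_finite_cover)
  then have "ennreal (dist x y) \<le> (\<Sum>i<N. ennreal (dist (u i) (v i)))"
    by (simp add: ennreal_leI)
  also have "\<dots> \<le> (\<Sum>i. ennreal (dist (u i) (v i)))"
    by (intro sum_le_suminf) auto
  finally show ?thesis .
qed


section \<open>The measure on halfspaces\<close>

lemma hs_outer_le:
  "E \<subseteq> (\<Union>n. hs_between (u n) (v n)) \<Longrightarrow> hs_outer E \<le> (\<Sum>n. ennreal (dist (u n) (v n)))"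
  unfolding hs_outer_def by (rule Inf_lower) blast

lemma hs_outer_greatest:
  assumes "\<And>u v. E \<subseteq> (\<Union>n. hs_between (u n) (v n)) \<Longrightarrow> c \<le> (\<Sum>n. ennreal (dist (u n) (v n)))"
  shows "c \<le> hs_outer E"
  unfolding hs_outer_def using assms by (intro Inf_greatest) blast

lemma hs_outer_cover:
  assumes "hs_outer E < c"
  obtains u v where "E \<subseteq> (\<Union>n. hs_between (u n) (v n))" "(\<Sum>n. ennreal (dist (u n) (v n))) < c"
  using assms unfolding hs_outer_def Inf_less_iff by blast

lemma hs_outer_mono: "E \<subseteq> F \<Longrightarrow> hs_outer E \<le> hs_outer F"
  by (rule hs_outer_greatest, rule hs_outer_le) auto

lemma hs_outer_empty [simp]: "hs_outer {} = 0"
  using hs_outer_le[of "{}" "\<lambda>_. undefined" "\<lambda>_. undefined"] by simp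

lemma hs_outer_hs_between [simp]: "hs_outer (hs_between x y) = dist x y"
proof (rule antisym)
  have "hs_outer (hs_between x y) \<le>
    (\<Sum>n::nat. ennreal (dist (if n = 0 then x else x) (if n = 0 then y else x)))"
    by (rule hs_outer_le) (auto intro: exI[of _ 0])
  also have "\<dots> = (\<Sum>n\<in>{0::nat}. ennreal (dist (if n = 0 then x else x) (if n = 0 then y else x)))"
    by (rule suminf_finite) auto
  finally show "hs_outer (hs_between x y) \<le> dist x y" by simp
  show "ennreal (dist x y) \<le> hs_outer (hs_between x y)"
    by (rule hs_outer_greatest) (rule dist_le_cover)
qed

text \<open>The usual argument: choose covers with errors e/2, e/4, ... and enumerate them together
  through \<open>prod_decode\<close>.\<close>

lemma hs_outer_UN: "hs_outer (\<Union>n. E n) \<le> (\<Sum>n. hs_outer (E n :: 'a::median_space set set))"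
proof (rule ennreal_le_epsilon)
  fix e :: real assume e: "0 < e" and fin: "(\<Sum>n. hs_outer (E n)) < top"
  have "\<exists>u v. E n \<subseteq> (\<Union>i. hs_between (u i) (v i)) \<and>
      (\<Sum>i. ennreal (dist (u i) (v i))) \<le> hs_outer (E n) + e * (1/2)^Suc n" for n
  proof -
    have "hs_outer (E n) < top" using fin by (rule ennreal_suminf_lessD)
    then have "hs_outer (E n) < hs_outer (E n) + e * (1/2)^Suc n"
      using e by (auto simp: less_top)
    then obtain u v where "E n \<subseteq> (\<Union>i. hs_between (u i) (v i))"
      "(\<Sum>i. ennreal (dist (u i) (v i))) < hs_outer (E n) + e * (1/2)^Suc n"
      by (rule hs_outer_cover)
    then show ?thesis using less_imp_le by blast
  qed
  then have "\<forall>n. \<exists>u v. E n \<subseteq> (\<Union>i. hs_between (u i) (v i)) \<and>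
      (\<Sum>i. ennreal (dist (u i) (v i))) \<le> hs_outer (E n) + e * (1/2)^Suc n"
    by blast
  from choice[OF this] obtain u where "\<forall>n. \<exists>v. E n \<subseteq> (\<Union>i. hs_between (u n i) (v i)) \<and>
      (\<Sum>i. ennreal (dist (u n i) (v i))) \<le> hs_outer (E n) + e * (1/2)^Suc n"
    by blast
  from choice[OF this] obtain v where uv: "\<And>n. E n \<subseteq> (\<Union>i. hs_between (u n i) (v n i))"
    and le: "\<And>n. (\<Sum>i. ennreal (dist (u n i) (v n i))) \<le> hs_outer (E n) + e * (1/2)^Suc n"
    by blast
  define f where "f = (\<lambda>(n, i). ennreal (dist (u n i) (v n i)))"
  define u' v' where "u' k = case_prod u (prod_decode k)" and "v' k = case_prod v (prod_decode k)" for k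
  have "hs_outer (\<Union>n. E n) \<le> (\<Sum>k. ennreal (dist (u' k) (v' k)))"
  proof (rule hs_outer_le, rule subsetI)
    fix h assume "h \<in> (\<Union>n. E n)"
    then obtain n i where "h \<in> hs_between (u n i) (v n i)" using uv by blast
    then have "h \<in> hs_between (u' (prod_encode (n, i))) (v' (prod_encode (n, i)))"
      by (simp add: u'_def v'_def)
    then show "h \<in> (\<Union>k. hs_between (u' k) (v' k))" by blast
  qed
  also have "\<dots> = (\<Sum>k. f (prod_decode k))"
    by (simp only: u'_def v'_def f_def split_def)
  also have "\<dots> = (\<Sum>n. \<Sum>i. f (n, i))"
    by (rule suminf_ennreal_2dimen) simp
  also have "\<dots> \<le> (\<Sum>n. hs_outer (E n) + e * (1/2)^Suc n)"
    using le by (intro suminf_le summableI) (simp add: f_def)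
  also have "\<dots> = (\<Sum>n. hs_outer (E n)) + (\<Sum>n. ennreal e * ennreal ((1/2) ^ Suc n))"
    using e by (subst suminf_add[symmetric])
      (auto simp del: ennreal_suminf_cmult simp add: ennreal_mult[symmetric])
  also have "\<dots> = (\<Sum>n. hs_outer (E n)) + e"
    unfolding ennreal_suminf_cmult
    by (subst suminf_ennreal_eq[OF zero_le_power power_half_series]) auto
  finally show "hs_outer (\<Union>n. E n) \<le> (\<Sum>n. hs_outer (E n)) + e" .
qed

lemma hs_outer_Un: "hs_outer (E \<union> F) \<le> hs_outer E + hs_outer (F :: 'a::median_space set set)"
proof -
  have "hs_outer (\<Union>n::nat. (if n = 0 then E else if n = 1 then F else {}))
    \<le> (\<Sum>n::nat. hs_outer (if n = 0 then E else if n = 1 then F else {}))"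
    by (rule hs_outer_UN)
  also have "\<dots> = (\<Sum>n\<in>{0,1::nat}. hs_outer (if n = 0 then E else if n = 1 then F else {}))"
    by (rule suminf_finite) auto
  also have "(\<Union>n::nat. (if n = 0 then E else if n = 1 then F else {})) = E \<union> F"
    by (auto split: if_splits intro: exI[of _ 0] exI[of _ 1])
  finally show ?thesis by simp
qed

section \<open>Caratheodory measurability and inner regularity\<close>

lemma outer_measure_space_hs_outer: "outer_measure_space (Pow halfspaces) hs_outer"
  unfolding outer_measure_space_def positive_def increasing_def countably_subadditive_def
  by (auto intro: hs_outer_mono hs_outer_UN)

text \<open>Caratheodory's criterion holds because \<open>hs_between a b\<close> cuts each covering
  set \<open>hs_between (u n) (v n)\<close> into one piece inside and two pieces outside, whose
  lengths add up exactly to the length of the covering set.\<close>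

lemma hs_between_lambda_system: "hs_between a b \<in> lambda_system halfspaces (Pow halfspaces) hs_outer"
proof -
  have "hs_outer (E \<inter> hs_between a b) + hs_outer (E - hs_between a b) \<le> hs_outer E" for E
  proof (rule hs_outer_greatest)
    fix u v :: "nat \<Rightarrow> 'a" assume E: "E \<subseteq> (\<Union>n. hs_between (u n) (v n))"
    define p q where "p n = cut_lo (u n) (v n) a b" and "q n = cut_hi (u n) (v n) b" for n
    have cut: "hs_between (u n) (v n) \<inter> hs_between a b = hs_between (p n) (q n)"
      "hs_between (u n) (v n) - hs_between a b = hs_between (u n) (p n) \<union> hs_between (q n) (v n)" for n
      unfolding p_def q_def by (rule hs_between_cut)+
    have "hs_outer (E \<inter> hs_between a b) \<le> (\<Sum>n. ennreal (dist (p n) (q n)))"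
      using E by (intro hs_outer_le) (auto simp flip: cut(1))
    moreover have "hs_outer (E - hs_between a b) \<le>
      hs_outer (\<Union>n. hs_between (u n) (p n)) + hs_outer (\<Union>n. hs_between (q n) (v n))"
    proof -
      have "E - hs_between a b \<subseteq> (\<Union>n. hs_between (u n) (p n)) \<union> (\<Union>n. hs_between (q n) (v n))"
        using E by (subst UN_Un_distrib[symmetric]) (auto simp flip: cut(2))
      then show ?thesis by (rule order_trans[OF hs_outer_mono hs_outer_Un])
    qed
    moreover have "hs_outer (\<Union>n. hs_between (u n) (p n)) \<le> (\<Sum>n. ennreal (dist (u n) (p n)))"
      "hs_outer (\<Union>n. hs_between (q n) (v n)) \<le> (\<Sum>n. ennreal (dist (q n) (v n)))"
      by (intro hs_outer_le order_refl)+
    ultimately have "hs_outer (E \<inter> hs_between a b) + hs_outer (E - hs_between a b)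
      \<le> (\<Sum>n. ennreal (dist (p n) (q n))) + ((\<Sum>n. ennreal (dist (u n) (p n))) + (\<Sum>n. ennreal (dist (q n) (v n))))"
      by (meson add_mono order_trans)
    also have "\<dots> = (\<Sum>n. ennreal (dist (p n) (q n)) + (ennreal (dist (u n) (p n)) + ennreal (dist (q n) (v n))))"
      by (simp add: suminf_add[symmetric] summableI)
    also have "\<dots> = (\<Sum>n. ennreal (dist (u n) (v n)))"
    proof (rule suminf_cong)
      fix n
      have "dist (u n) (v n) = dist (u n) (p n) + dist (p n) (q n) + dist (q n) (v n)"
        unfolding p_def q_def by (rule dist_cut)
      then show "ennreal (dist (p n) (q n)) + (ennreal (dist (u n) (p n)) + ennreal (dist (q n) (v n)))
        = ennreal (dist (u n) (v n))"
        by (simp add: ennreal_plus[symmetric] add.commute add.left_commute del: ennreal_plus)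
    qed
    finally show "hs_outer (E \<inter> hs_between a b) + hs_outer (E - hs_between a b)
      \<le> (\<Sum>n. ennreal (dist (u n) (v n)))" .
  qed
  moreover have "hs_outer E \<le> hs_outer (E \<inter> hs_between a b) + hs_outer (E - hs_between a b)" for E
    using hs_outer_Un[of "E \<inter> hs_between a b" "E - hs_between a b"] by (simp add: Int_Diff_Un)
  ultimately show ?thesis
    using hs_between_subset[of a b] by (auto simp: algebra.lambda_system_eq[OF algebra_Pow] intro: antisym)
qed

lemma space_hs_measure [simp]: "space hs_measure = halfspaces"
  unfolding hs_measure_def by (rule space_measure_of) (auto simp: hs_between_def)

lemma sets_hs_measure: "sets hs_measure = sigma_sets halfspaces {H. \<exists>x y. H = hs_between x y}"
  unfolding hs_measure_def by (rule sets_measure_of) (auto simp: hs_between_def)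

lemma hs_between_sets [simp]: "hs_between x y \<in> sets hs_measure"
  unfolding sets_hs_measure by (rule sigma_sets.Basic) blast

text \<open>A measure built by \<open>measure_of\<close> takes the prescribed values once these are
  countably additive on the generated sigma-algebra. Here the lambda-system, on which Caratheodory's
  lemma gives additivity, contains the generators.\<close>

lemma emeasure_hs_measure:
  assumes "A \<in> sets hs_measure"
  shows "emeasure hs_measure A = hs_outer (A :: 'a::median_space set set)"
proof -
  let ?L = "lambda_system halfspaces (Pow halfspaces) (hs_outer :: 'a set set \<Rightarrow> ennreal)"
  have L: "measure_space halfspaces ?L hs_outer"
    by (rule sigma_algebra.caratheodory_lemma[OF sigma_algebra_Pow outer_measure_space_hs_outer])
  then interpret sigma_algebra "halfspaces :: 'a set set" ?L by (simp add: measure_space_def)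
  have sub: "sets (hs_measure :: 'a set measure) \<subseteq> ?L"
    unfolding sets_hs_measure using hs_between_lambda_system by (intro sigma_sets_subset) auto
  have "countably_additive (sets hs_measure) (hs_outer :: 'a set set \<Rightarrow> ennreal)"
    using L sub unfolding measure_space_def countably_additive_def by (meson order_trans subsetD)
  then show ?thesis
    using assms by (intro emeasure_measure_of[OF hs_measure_def])
      (auto simp: hs_between_def positive_def)
qed

lemma null_hs_measure_outer: "N \<in> null_sets hs_measure \<Longrightarrow> hs_outer N = 0"
  by (simp add: null_sets_def flip: emeasure_hs_measure)

text \<open>A set of the completion differs from a measurable subset by part of a null set, which
  the outer measure does not see. All later estimates can therefore be made with
  \<open>hs_outer\<close>, which is defined on every set.\<close>

lemma emeasure_completion_hs_measure:
  assumes "A \<in> sets (completion hs_measure)"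
  shows "emeasure (completion hs_measure) A = hs_outer A"
proof -
  obtain S N N' where A: "A = S \<union> N" "N \<subseteq> N'" "N' \<in> null_sets hs_measure" "S \<in> sets hs_measure"
    using assms by (rule sets_completionE)
  have "N \<in> null_sets (completion hs_measure)"
    using A(2,3) by (rule null_sets_completion_subset[OF _ null_sets_completionI])
  then have "emeasure (completion hs_measure) A = emeasure (completion hs_measure) S"
    unfolding A(1) using A(4) by (intro emeasure_Un_null_set) auto
  then have "emeasure (completion hs_measure) A = hs_outer S"
    using A(4) by (simp add: emeasure_hs_measure)
  moreover have "hs_outer A \<le> hs_outer S + hs_outer N'"
    using A by (metis Un_mono hs_outer_Un hs_outer_mono order_refl order_trans)
  ultimately show ?thesis
    using hs_outer_mono[of S A] null_hs_measure_outer[OF A(3)] A(1) by (auto intro: antisym)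
qed

text \<open>This is inner regularity: the inner set is compact in \<open>2\<^sup>X\<close>.\<close>

lemma hs_inner_approx:
  assumes S: "S \<in> sets (completion hs_measure)" "S \<subseteq> hs_between x y" and e: "(e::real) > 0"
  obtains u v where "hs_between x y - (\<Union>n::nat. hs_between (u n) (v n)) \<subseteq> S"
    "hs_outer (S \<inter> (\<Union>n. hs_between (u n) (v n))) \<le> e"
proof -
  let ?H = "hs_between x y" and ?M = "completion hs_measure"
  have T: "?H - S \<in> sets ?M" using S(1) by auto
  have fin: "hs_outer (?H - S) < top"
    using hs_outer_mono[of "?H - S" ?H] by (auto simp: less_top[symmetric] top_unique)
  \<comment> \<open>The complement of \<open>S\<close> is covered almost optimally. What remains of
    \<open>?H\<close> outside the cover lies in \<open>S\<close>, and the loss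
    \<open>S \<inter> ?C\<close> is bounded by the excess of the cover.\<close>
  then have "hs_outer (?H - S) < hs_outer (?H - S) + e" using e by (simp add: less_top)
  then obtain u v where uv: "?H - S \<subseteq> (\<Union>n::nat. hs_between (u n) (v n))"
    "(\<Sum>n. ennreal (dist (u n) (v n))) < hs_outer (?H - S) + e"
    by (rule hs_outer_cover)
  let ?C = "\<Union>n. hs_between (u n) (v n)"
  have C: "?C \<in> sets ?M" by (intro sets_completionI_sets sets.countable_UN) auto
  \<comment> \<open>The two sets are disjoint and measurable for the completion, so their measures
    add; the finite term \<open>hs_outer (?H - S)\<close> is cancelled at the end.\<close>
  have "hs_outer (?H - S) + hs_outer (S \<inter> ?C) = emeasure ?M (?H - S) + emeasure ?M (S \<inter> ?C)"
    using S T C by (simp add: emeasure_completion_hs_measure del: emeasure_completion)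
  also have "\<dots> = emeasure ?M ((?H - S) \<union> (S \<inter> ?C))"
    using S T C by (intro plus_emeasure) auto
  also have "\<dots> = hs_outer ((?H - S) \<union> (S \<inter> ?C))"
    using S T C by (intro emeasure_completion_hs_measure) auto
  also have "\<dots> \<le> hs_outer ?C" using uv(1) by (intro hs_outer_mono) auto
  also have "\<dots> \<le> (\<Sum>n. ennreal (dist (u n) (v n)))" by (rule hs_outer_le) simp
  also have "\<dots> \<le> hs_outer (?H - S) + e" using uv(2) by simp
  finally have "hs_outer (S \<inter> ?C) \<le> e" using fin by (auto simp: less_top)
  moreover have "?H - ?C \<subseteq> S" using uv(1) by blast
  ultimately show thesis using that by blast
qed


section \<open>Measurable ultrafilters are represented by points of intervals\<close>

text \<open>Order \<open>interval x y\<close> by letting p \<le> q mean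
  \<open>p \<in> interval x q\<close>. Then \<open>med y p q\<close> is an upper bound of
  \<open>p\<close> and \<open>q\<close>, their join.\<close>

lemma interval_join:
  fixes x :: "'a::median_space"
  assumes "p \<in> interval x y" "q \<in> interval x y"
  shows "med y p q \<in> interval x y" "p \<in> interval x (med y p q)" "q \<in> interval x (med y p q)"
proof -
  have *: "((x \<in> h \<and> y \<in> h \<longrightarrow> p \<in> h) \<and> (x \<notin> h \<and> y \<notin> h \<longrightarrow> p \<notin> h)) \<and>
      ((x \<in> h \<and> y \<in> h \<longrightarrow> q \<in> h) \<and> (x \<notin> h \<and> y \<notin> h \<longrightarrow> q \<notin> h)) \<and>
      (med y p q \<in> h \<longleftrightarrow> (y \<in> h \<and> p \<in> h) \<or> (p \<in> h \<and> q \<in> h) \<or> (q \<in> h \<and> y \<in> h))"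
    if h: "h \<in> halfspaces" for h
    using in_intervalD[OF assms(1) h] in_intervalD[OF assms(2) h] med_in_halfspace[OF h] by auto
  show "med y p q \<in> interval x y" "p \<in> interval x (med y p q)" "q \<in> interval x (med y p q)"
    by (rule in_intervalI, drule *, argo)+
qed

lemma closed_interval: "closed (interval x y)"
  for x :: "'a::metric_space"
proof -
  have "interval x y = {z. dist x y = dist x z + dist z y}" by (auto simp: interval_iff)
  also have "closed \<dots>" by (intro closed_Collect_eq continuous_intros)
  finally show ?thesis .
qed

text \<open>In the order of \<open>interval x y\<close> starting at \<open>x\<close>, a nonempty
  subset closed under joins has a supremum in its closure. It is the limit of points whose distances
  from \<open>x\<close> tend to the supremum \<open>D\<close> of such distances.\<close>

lemma ex_interval_sup:
  fixes x :: "'a::median_space"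
  assumes compl: "complete (UNIV :: 'a set)"
    and A: "A \<subseteq> interval x y" "A \<noteq> {}" and join: "\<And>p q. p \<in> A \<Longrightarrow> q \<in> A \<Longrightarrow> med y p q \<in> A"
  obtains s where "s \<in> interval x y" "\<And>p. p \<in> A \<Longrightarrow> p \<in> interval x s"
    "\<And>e. e > 0 \<Longrightarrow> \<exists>r\<in>A. dist r s < e"
proof -
  define D where "D = Sup (dist x ` A)"
  have bdd: "bdd_above (dist x ` A)"
    using A(1) by (intro bdd_aboveI[of _ "dist x y"]) (auto simp: interval_iff dest!: subsetD)
  have le: "dist x p \<le> D" if "p \<in> A" for p
    unfolding D_def using that bdd by (intro cSup_upper) auto
  \<comment> \<open>The join stays in \<open>A\<close>, so its distance from \<open>x\<close> is at
    most \<open>D\<close>, and it lies beyond \<open>p\<close> and \<open>q\<close>. A point whose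
    distance from \<open>x\<close> is nearly \<open>D\<close> is therefore close to all its
    joins.\<close>
  have jn: "dist p (med y p q) \<le> D - dist x p" "p \<in> interval x (med y p q)"
    "dist q (med y p q) \<le> D - dist x q"
    if "p \<in> A" "q \<in> A" for p q
  proof -
    have *: "p \<in> interval x (med y p q)" "q \<in> interval x (med y p q)"
      using that A(1) interval_join by blast+
    then show "dist p (med y p q) \<le> D - dist x p" "dist q (med y p q) \<le> D - dist x q"
      using le[OF join[OF that]] by (simp_all add: interval_iff)
    show "p \<in> interval x (med y p q)" by (fact *)
  qed
  have "\<exists>p\<in>A. D - inverse (Suc n) < dist x p" for n
  proof -
    have "D - inverse (Suc n) < D" by simp
    then show ?thesis unfolding D_def using A(2) bdd by (subst (asm) less_cSup_iff) auto
  qed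
  then have "\<forall>n. \<exists>p. p \<in> A \<and> D - inverse (Suc n) < dist x p" by blast
  from choice[OF this] obtain a where a: "\<And>n. a n \<in> A" "\<And>n. D - inverse (Suc n) < dist x (a n)"
    by blast
  have close: "dist p (a n) \<le> (D - dist x p) + inverse (Suc n)" if "p \<in> A" for p n
    using jn(1,3)[OF that a(1)[of n]] a(2)[of n] dist_triangle2[of p "a n" "med y p (a n)"] by linarith
  have "Cauchy a"
  proof (rule metric_CauchyI)
    fix e :: real assume "e > 0"
    then obtain N where N: "inverse (real (Suc N)) < e / 2" using reals_Archimedean[of "e/2"] by auto
    have "dist (a m) (a n) < e" if "m \<ge> N" "n \<ge> N" for m n
    proof -
      have "inverse (real (Suc m)) \<le> inverse (real (Suc N))" "inverse (real (Suc n)) \<le> inverse (real (Suc N))"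
        using that by (simp_all add: le_imp_inverse_le)
      then show ?thesis using close[OF a(1)[of m], of n] a(2)[of m] N by linarith
    qed
    then show "\<exists>M. \<forall>m\<ge>M. \<forall>n\<ge>M. dist (a m) (a n) < e" by blast
  qed
  then obtain s where s: "a \<longlonglongrightarrow> s" using compl unfolding complete_def by auto
  show thesis
  proof
    show "s \<in> interval x y"
      using closed_sequentially[OF closed_interval _ s] a(1) A(1) by blast
    show "\<exists>r\<in>A. dist r s < e" if "e > 0" for e
      using metric_LIMSEQ_D[OF s that] a(1) by blast
    fix p assume p: "p \<in> A"
    \<comment> \<open>The joins of \<open>p\<close> with \<open>a n\<close> also converge to
      \<open>s\<close>. Each of them has \<open>p\<close> on its way from \<open>x\<close>, and this
      equation between distances passes to the limit.\<close>
    have "(\<lambda>n. dist (a n) (med y p (a n))) \<longlonglongrightarrow> 0"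
    proof (rule tendsto_sandwich[OF _ _ tendsto_const LIMSEQ_inverse_real_of_nat])
      show "\<forall>\<^sub>F n in sequentially. dist (a n) (med y p (a n)) \<le> inverse (real (Suc n))"
      proof (rule always_eventually, rule allI)
        fix n show "dist (a n) (med y p (a n)) \<le> inverse (real (Suc n))"
          using jn(3)[OF p a(1)[of n]] a(2)[of n] by linarith
      qed
    qed simp
    then have "(\<lambda>n. dist (a n) (med y p (a n)) + dist (a n) s) \<longlonglongrightarrow> 0"
      using tendsto_add[OF _ s[unfolded tendsto_dist_iff[of a]]] by fastforce
    then have j: "(\<lambda>n. med y p (a n)) \<longlonglongrightarrow> s"
      unfolding tendsto_dist_iff[of "\<lambda>n. med y p (a n)"]
      by (rule tendsto_sandwich[OF _ _ tendsto_const, rotated 2]) (simp_all add: dist_triangle3)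
    have "(\<lambda>n. dist x (med y p (a n))) \<longlonglongrightarrow> dist x p + dist p s"
      using jn(2)[OF p a(1)] by (simp add: interval_iff) (intro tendsto_intros j)
    moreover have "(\<lambda>n. dist x (med y p (a n))) \<longlonglongrightarrow> dist x s"
      by (intro tendsto_intros j)
    ultimately show "p \<in> interval x s"
      unfolding interval_iff using LIMSEQ_unique by blast
  qed
qed

lemma hs_outer_eq_0I:
  assumes "\<And>e::real. 0 < e \<Longrightarrow> hs_outer E \<le> ennreal e"
  shows "hs_outer E = 0"
proof -
  have "hs_outer E \<le> 0" by (rule ennreal_le_epsilon) (simp add: assms)
  then show ?thesis by simp
qed

section \<open>Upward closed sets of halfspaces and their representing points\<close>

lemma hs_ultrafilter_mono:
  assumes "hs_ultrafilter \<sigma>" "h \<in> \<sigma>" "h \<subseteq> k" "k \<in> halfspaces"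
  shows "k \<in> \<sigma>"
proof (rule ccontr)
  assume "k \<notin> \<sigma>"
  then have "- k \<in> \<sigma>" using assms(1,4) by (auto simp: hs_ultrafilter_def)
  then have "h \<inter> - k \<noteq> {}" using assms(1,2) unfolding hs_ultrafilter_def by blast
  then show False using assms(3) by blast
qed

text \<open>Join the points one at a time: a median of three points, two of which lie outside
  \<open>h\<close>, lies outside \<open>h\<close>. The induction starts from \<open>x\<close>, whose
  halfspace-interval is empty.\<close>

lemma hs_between_finite_join:
  fixes x :: "'a::median_space"
  assumes h: "h \<in> halfspaces" "x \<notin> h" and P: "finite P" "P \<subseteq> interval x y - h"
  shows "\<exists>j\<in>interval x y - h. (\<Union>p\<in>P. hs_between x p) \<subseteq> hs_between x j"
  using P
proof (induction P)
  case empty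
  then show ?case using h by (intro bexI[of _ x]) auto
next
  case (insert p P)
  then obtain j where j: "j \<in> interval x y - h" "(\<Union>p\<in>P. hs_between x p) \<subseteq> hs_between x j" by auto
  have p: "p \<in> interval x y - h" using insert.prems by auto
  let ?j = "med y p j"
  have "?j \<in> interval x y" "p \<in> interval x ?j" "j \<in> interval x ?j"
    using interval_join j(1) p by blast+
  moreover have "?j \<notin> h" using p j(1) h(1) by (simp add: med_in_halfspace)
  moreover have "hs_between x q \<subseteq> hs_between x ?j" if "q \<in> interval x ?j" for q
    using in_intervalD[OF that] unfolding hs_between_def by blast
  ultimately show ?case using j(2) by (intro bexI[of _ ?j]) auto
qed

text \<open>\<open>K\<close> is compact, so its upward closure in \<open>hs_between x y\<close> is an intersection of sets
  \<open>hs_between x p\<close> (Priestley separation). The point \<open>s\<close> is the infimum of these \<open>p\<close>.\<close>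

lemma compact_upset_point:
  fixes x y :: "'a::median_space" and u v :: "nat \<Rightarrow> 'a"
  assumes compl: "complete (UNIV :: 'a set)" and \<sigma>: "hs_ultrafilter \<sigma>"
  defines "K \<equiv> hs_between x y - (\<Union>n. hs_between (u n) (v n))"
  assumes K: "K \<subseteq> \<sigma>"
  obtains s where "s \<in> interval x y" "hs_between x s \<subseteq> \<sigma>" "hs_outer (K - hs_between x s) = 0"
proof -
  \<comment> \<open>\<open>F\<close> is closed under the meets \<open>med x p q\<close>. Applying
    \<open>ex_interval_sup\<close> with the endpoints exchanged turns the supremum seen from
    \<open>y\<close> into an infimum \<open>s\<close> seen from \<open>x\<close>.\<close>
  define F where "F = {p \<in> interval x y. K \<subseteq> hs_between x p}"
  have "y \<in> F" by (auto simp: F_def K_def)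
  moreover have "F \<subseteq> interval y x" by (auto simp: F_def interval_commute)
  moreover have "med x p q \<in> F" if "p \<in> F" "q \<in> F" for p q
  proof -
    have "med x p q \<in> interval x y"
      using interval_join(1)[of p y x q] that by (simp add: F_def interval_commute)
    moreover have "hs_between x p \<inter> hs_between x q \<subseteq> hs_between x (med x p q)"
      by (auto simp: hs_between_def med_in_halfspace)
    ultimately show ?thesis using that by (auto simp: F_def)
  qed
  ultimately obtain s where s: "s \<in> interval y x" "\<And>p. p \<in> F \<Longrightarrow> p \<in> interval y s"
    "\<And>e. e > 0 \<Longrightarrow> \<exists>r\<in>F. dist r s < e"
    using ex_interval_sup[OF compl, of F y x] by blast
  have "hs_between x s \<subseteq> \<sigma>"
  proof
    fix h assume h: "h \<in> hs_between x s"
    then have hh: "h \<in> halfspaces" "x \<notin> h" "s \<in> h" by (auto simp: hs_between_def)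
    then have yh: "y \<in> h" using in_intervalD[OF s(1)] by blast
    \<comment> \<open>If every \<open>k\<close> in \<open>K\<close> leaves \<open>h\<close>, it
      belongs to \<open>hs_between x p\<close> for some \<open>p\<close> of the interval outside
      \<open>h\<close>. By compactness finitely many such \<open>p\<close> serve all of
      \<open>K\<close>, and their join \<open>j \<notin> h\<close> lies in \<open>F\<close>. But
      then \<open>j\<close> is between \<open>y\<close> and \<open>s\<close>, which are both in
      \<open>h\<close>.\<close>
    have "\<exists>k\<in>K. k \<subseteq> h"
    proof (rule ccontr)
      assume no: "\<not> ?thesis"
      let ?P = "interval x y - h"
      let ?A = "range (\<lambda>n. (u n, v n)) \<union> Pair x ` ?P"
      have "hs_between x y \<subseteq> (\<Union>i\<in>?A. hs_between (fst i) (snd i))"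
      proof
        fix k assume k: "k \<in> hs_between x y"
        show "k \<in> (\<Union>i\<in>?A. hs_between (fst i) (snd i))"
        proof (cases "k \<in> K")
          case True
          then obtain z where z: "z \<in> k" "z \<notin> h" using no by blast
          \<comment> \<open>The witness \<open>z\<close> is moved into the interval: its projection
            stays in \<open>k\<close> because \<open>y \<in> k\<close>, and outside \<open>h\<close>
            because \<open>x \<notin> h\<close>.\<close>
          have "med x y z \<in> k" "med x y z \<notin> h"
            using z k hh by (auto simp: hs_between_def med_in_halfspace)
          then have "med x y z \<in> ?P" "k \<in> hs_between x (med x y z)"
            using k by (auto simp: hs_between_def)
          then show ?thesis by fastforce
        next
          case False
          then show ?thesis using k by (auto simp: K_def)
        qed
      qed
      then obtain B where B: "finite B" "B \<subseteq> ?A" "hs_between x y \<subseteq> (\<Union>i\<in>B. hs_between (fst i) (snd i))"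
        by (rule hs_between_finite_subcover)
      define P where "P = {p \<in> ?P. (x, p) \<in> B}"
      have "P \<subseteq> snd ` B" by (force simp: P_def)
      then have "finite P" using B(1) finite_surj by blast
      moreover have "P \<subseteq> ?P" by (auto simp: P_def)
      ultimately obtain j where j: "j \<in> ?P" "(\<Union>p\<in>P. hs_between x p) \<subseteq> hs_between x j"
        using hs_between_finite_join[OF hh(1,2)] by metis
      have "K \<subseteq> (\<Union>p\<in>P. hs_between x p)"
      proof
        fix k assume k: "k \<in> K"
        then obtain i where i: "i \<in> B" "k \<in> hs_between (fst i) (snd i)" using B(3) by (auto simp: K_def)
        then have "i \<notin> range (\<lambda>n. (u n, v n))" using k by (auto simp: K_def)
        then obtain p where "p \<in> ?P" "i = (x, p)" using i(1) B(2) by blast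
        then show "k \<in> (\<Union>p\<in>P. hs_between x p)" using i by (auto simp: P_def)
      qed
      then have "j \<in> F" using j by (auto simp: F_def)
      then have "j \<in> h" using s(2) in_intervalD[OF _ hh(1)] hh(3) yh by blast
      then show False using j(1) by blast
    qed
    then show "h \<in> \<sigma>" using hs_ultrafilter_mono[OF \<sigma> _ _ hh(1)] K by blast
  qed
  have "hs_outer (K - hs_between x s) \<le> ennreal e" if e: "e > 0" for e :: real
  proof -
    obtain r where r: "r \<in> F" "dist r s < e" using s(3)[OF e] by blast
    \<comment> \<open>Points \<open>r\<close> of \<open>F\<close> come arbitrarily close to the
      infimum \<open>s\<close>, and \<open>K\<close> lies in \<open>hs_between x r\<close>.\<close>
    have "K - hs_between x s \<subseteq> hs_between s r"
      using r(1) by (auto simp: F_def hs_between_def)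
    then have "hs_outer (K - hs_between x s) \<le> ennreal (dist s r)"
      by (subst hs_outer_hs_between[symmetric]) (rule hs_outer_mono)
    moreover have "dist s r \<le> e" using r(2) by (simp add: dist_commute)
    ultimately show ?thesis
      using ennreal_leI order_trans by blast
  qed
  then have "hs_outer (K - hs_between x s) = 0" by (rule hs_outer_eq_0I)
  with s(1) \<open>hs_between x s \<subseteq> \<sigma>\<close> show thesis
    by (intro that) (simp_all add: interval_commute)
qed

text \<open>The point \<open>s\<close> is the supremum of all \<open>p\<close> with
  \<open>hs_between x p \<subseteq> \<sigma>\<close>. Since such \<open>p\<close> approximate it,
  \<open>hs_between x s\<close> lies in \<sigma> up to a null set. Conversely, up to null sets each
  compact inner approximation is contained in \<open>hs_between x p\<close> for one of these
  \<open>p\<close>, hence in \<open>hs_between x s\<close>.\<close>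

lemma measurable_ultrafilter_point:
  fixes x :: "'a::median_space"
  assumes compl: "complete (UNIV :: 'a set)" and \<sigma>: "hs_ultrafilter \<sigma>" "morally_measurable \<sigma>"
  obtains s where "s \<in> interval x y" "hs_outer (\<sigma> \<inter> hs_between x y - hs_between x s) = 0"
    "hs_outer (hs_between x s - \<sigma>) = 0"
proof -
  define A where "A = {p \<in> interval x y. hs_between x p \<subseteq> \<sigma>}"
  have "x \<in> A" by (auto simp: A_def)
  moreover have "A \<subseteq> interval x y" by (auto simp: A_def)
  moreover have "med y p q \<in> A" if "p \<in> A" "q \<in> A" for p q
  proof -
    have "hs_between x (med y p q) \<subseteq> hs_between x p \<union> hs_between x q"
      by (auto simp: hs_between_def med_in_halfspace)
    then show ?thesis using that interval_join(1)[of p x y q] by (auto simp: A_def)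
  qed
  ultimately obtain s where s: "s \<in> interval x y" "\<And>p. p \<in> A \<Longrightarrow> p \<in> interval x s"
    "\<And>e. e > 0 \<Longrightarrow> \<exists>r\<in>A. dist r s < e"
    using ex_interval_sup[OF compl, of A x y] by blast
  have "hs_outer (hs_between x s - \<sigma>) \<le> ennreal e" if e: "e > 0" for e :: real
  proof -
    obtain r where r: "r \<in> A" "dist r s < e" using s(3)[OF e] by blast
    have "hs_between x s - \<sigma> \<subseteq> hs_between r s"
      using r(1) by (auto simp: A_def hs_between_def)
    then have "hs_outer (hs_between x s - \<sigma>) \<le> ennreal (dist r s)"
      by (subst hs_outer_hs_between[symmetric]) (rule hs_outer_mono)
    moreover have "dist r s \<le> e" using r(2) by simp
    ultimately show ?thesis
      using ennreal_leI order_trans by blast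
  qed
  then have 0: "hs_outer (hs_between x s - \<sigma>) = 0" by (rule hs_outer_eq_0I)
  have "hs_outer (\<sigma> \<inter> hs_between x y - hs_between x s) = 0"
  proof (rule hs_outer_eq_0I)
    fix e :: real assume e: "e > 0"
    have "\<sigma> \<inter> hs_between x y \<in> sets (completion hs_measure)"
      using \<sigma>(2) by (simp add: morally_measurable_def)
    then obtain u v where uv: "hs_between x y - (\<Union>n::nat. hs_between (u n) (v n)) \<subseteq> \<sigma> \<inter> hs_between x y"
      "hs_outer (\<sigma> \<inter> hs_between x y \<inter> (\<Union>n. hs_between (u n) (v n))) \<le> e"
      by (rule hs_inner_approx[OF _ _ e]) auto
    let ?C = "\<Union>n. hs_between (u n) (v n)"
    obtain p where p: "p \<in> interval x y" "hs_between x p \<subseteq> \<sigma>"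
      "hs_outer (hs_between x y - ?C - hs_between x p) = 0"
      using compact_upset_point[OF compl \<sigma>(1), of x y u v] uv(1) by auto
    then have "p \<in> interval x s" using s(2) by (simp add: A_def)
    then have "hs_between x p \<subseteq> hs_between x s"
      using in_intervalD unfolding hs_between_def by fastforce
    then have "\<sigma> \<inter> hs_between x y - hs_between x s \<subseteq>
      \<sigma> \<inter> hs_between x y \<inter> ?C \<union> (hs_between x y - ?C - hs_between x p)" by blast
    then have "hs_outer (\<sigma> \<inter> hs_between x y - hs_between x s) \<le>
      hs_outer (\<sigma> \<inter> hs_between x y \<inter> ?C) + hs_outer (hs_between x y - ?C - hs_between x p)"
      by (rule order_trans[OF hs_outer_mono hs_outer_Un])
    then show "hs_outer (\<sigma> \<inter> hs_between x y - hs_between x s) \<le> e"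
      using uv(2) p(3) by simp
  qed
  from that[OF s(1) this 0] show thesis .
qed


section \<open>Gate projections onto intervals\<close>

text \<open>These are the halfspaces about which the coordinate at \<open>I\<close> of a point of
  the Roller compactification decides.\<close>

definition hs_separating :: "'a::median_space set \<Rightarrow> 'a set set" where
  "hs_separating I = {h \<in> halfspaces. I \<inter> h \<noteq> {} \<and> I \<inter> - h \<noteq> {}}"

lemma interval_in_intervals [simp]: "interval x y \<in> intervals"
  by (auto simp: intervals_def)

lemma hs_separating_interval:
  "hs_separating (interval x y) = hs_between x y \<union> hs_between y x"
proof (intro equalityI subsetI)
  fix h assume "h \<in> hs_separating (interval x y)"
  then obtain a b where "h \<in> halfspaces" "a \<in> interval x y" "a \<in> h" "b \<in> interval x y" "b \<notin> h"
    by (auto simp: hs_separating_def)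
  then show "h \<in> hs_between x y \<union> hs_between y x"
    using in_intervalD[of a x y h] in_intervalD[of b x y h] by (auto simp: hs_between_def)
next
  fix h assume "h \<in> hs_between x y \<union> hs_between y x"
  then show "h \<in> hs_separating (interval x y)"
    unfolding hs_separating_def hs_between_def
    by (auto intro: endpoints_in_interval simp: disjoint_iff)
qed

lemma hs_separating_subset: "h \<in> hs_separating K \<Longrightarrow> K \<subseteq> I \<Longrightarrow> h \<in> hs_separating I"
  by (auto simp: hs_separating_def)

lemma hs_separating_halfspace: "h \<in> hs_separating K \<Longrightarrow> h \<in> halfspaces"
  by (auto simp: hs_separating_def)

text \<open>If \<open>interval a b\<close> is the same set, a halfspace contains both of
  \<open>a, b\<close> exactly when it contains both of \<open>x, y\<close>, and likewise for
  complements. The two medians with \<open>z\<close> then lie in the same halfspaces, so the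
  definite description is justified.\<close>

lemma iproj_interval:
  fixes x :: "'a::median_space"
  shows "iproj (interval x y) z = med x y z"
  unfolding iproj_def
proof (rule the_equality)
  fix p assume "\<exists>a b. interval x y = interval a b \<and> p = med a b z"
  then obtain a b where ab: "interval x y = interval a b" "p = med a b z" by blast
  then have "x \<in> interval a b" "y \<in> interval a b" "a \<in> interval x y" "b \<in> interval x y"
    using endpoints_in_interval by blast+
  note * = this[THEN in_intervalD]
  show "p = med x y z"
  proof (rule eq_by_halfspaces)
    fix h :: "'a set" assume h: "h \<in> halfspaces"
    show "p \<in> h \<longleftrightarrow> med x y z \<in> h"
      unfolding ab(2) med_in_halfspace[OF h] using *[OF h] by argo
  qed
qed blast

lemma iproj_in:
  assumes "I \<in> intervals"
  shows "iproj I z \<in> I"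
  using assms by (auto simp: intervals_def iproj_interval)

lemma iproj_halfspace:
  assumes "I \<in> intervals" "h \<in> hs_separating I"
  shows "iproj I z \<in> h \<longleftrightarrow> z \<in> h"
  using assms
  by (auto simp: intervals_def iproj_interval hs_separating_interval hs_between_def med_in_halfspace)

text \<open>A halfspace that does not split \<open>K\<close> cannot separate two of its points, so
  equality needs testing only on those that do. On these, \<open>iproj\<close> is invisible by
  \<open>iproj_halfspace\<close>, which reduces identities for gates to propositional ones.\<close>

lemma eq_in_interval:
  assumes "a \<in> K" "b \<in> K" "\<And>h. h \<in> hs_separating K \<Longrightarrow> a \<in> h \<longleftrightarrow> b \<in> h"
  shows "a = (b :: 'a::median_space)"
proof (rule eq_by_halfspaces)
  fix h :: "'a set" assume "h \<in> halfspaces"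
  then show "a \<in> h \<longleftrightarrow> b \<in> h"
    using assms(1,2) assms(3)[of h] by (cases "h \<in> hs_separating K") (auto simp: hs_separating_def)
qed

lemma iproj_self:
  assumes "I \<in> intervals" "z \<in> I"
  shows "iproj I z = z"
  using assms by (intro eq_in_interval[of _ I]) (simp_all add: iproj_in iproj_halfspace)

lemma iproj_iproj:
  assumes "K \<in> intervals" "I \<in> intervals" "K \<subseteq> I"
  shows "iproj K (iproj I z) = iproj K z"
  using assms hs_separating_subset[OF _ assms(3)]
  by (intro eq_in_interval[of _ K]) (simp_all add: iproj_in iproj_halfspace)

lemma med_in_intervals:
  assumes "I \<in> intervals" "a \<in> I" "b \<in> I"
  shows "med a b c \<in> I"
proof -
  obtain x y where I: "I = interval x y" using assms(1) by (auto simp: intervals_def)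
  show ?thesis using assms(2,3) unfolding I by (rule interval_convex) simp
qed

lemma iproj_med:
  assumes "I \<in> intervals"
  shows "iproj I (med a b c) = med (iproj I a) (iproj I b) (iproj I c)"
  using assms
  by (intro eq_in_interval[of _ I])
    (simp_all add: iproj_in iproj_halfspace med_in_intervals med_in_halfspace[OF hs_separating_halfspace])

text \<open>The new endpoints are the gates of \<open>c\<close> and \<open>d\<close> in
  \<open>interval a b\<close>. The common point \<open>p\<close> rules out halfspaces containing one
  interval and disjoint from the other; in all other cases the claim is propositional.\<close>

lemma interval_Int:
  fixes a :: "'a::median_space"
  assumes p: "p \<in> interval a b" "p \<in> interval c d"
  shows "interval a b \<inter> interval c d = interval (med a b c) (med a b d)"
proof -
  have p': "(((a \<in> h \<and> b \<in> h \<longrightarrow> p \<in> h) \<and> (a \<notin> h \<and> b \<notin> h \<longrightarrow> p \<notin> h)) \<and>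
      ((c \<in> h \<and> d \<in> h \<longrightarrow> p \<in> h) \<and> (c \<notin> h \<and> d \<notin> h \<longrightarrow> p \<notin> h))) \<and>
      (med a b c \<in> h \<longleftrightarrow> (a \<in> h \<and> b \<in> h) \<or> (b \<in> h \<and> c \<in> h) \<or> (c \<in> h \<and> a \<in> h)) \<and>
      (med a b d \<in> h \<longleftrightarrow> (a \<in> h \<and> b \<in> h) \<or> (b \<in> h \<and> d \<in> h) \<or> (d \<in> h \<and> a \<in> h))"
    if h: "h \<in> halfspaces" for h
    using in_intervalD[OF p(1) h] in_intervalD[OF p(2) h] med_in_halfspace[OF h] by simp
  show ?thesis
  proof (intro equalityI subsetI IntI)
    fix z assume z: "z \<in> interval a b \<inter> interval c d"
    then have z1: "z \<in> interval a b" "z \<in> interval c d" by auto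
    show "z \<in> interval (med a b c) (med a b d)"
    proof (rule in_intervalI)
      fix h :: "'a set" assume h: "h \<in> halfspaces"
      show "(med a b c \<in> h \<and> med a b d \<in> h \<longrightarrow> z \<in> h) \<and> (med a b c \<notin> h \<and> med a b d \<notin> h \<longrightarrow> z \<notin> h)"
        using in_intervalD[OF z1(1) h] in_intervalD[OF z1(2) h] p'[OF h] by argo
    qed
  next
    fix z assume z: "z \<in> interval (med a b c) (med a b d)"
    have *: "((med a b c \<in> h \<and> med a b d \<in> h \<longrightarrow> z \<in> h) \<and>
      (med a b c \<notin> h \<and> med a b d \<notin> h \<longrightarrow> z \<notin> h)) \<and>
      (((a \<in> h \<and> b \<in> h \<longrightarrow> p \<in> h) \<and> (a \<notin> h \<and> b \<notin> h \<longrightarrow> p \<notin> h)) \<and>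
      ((c \<in> h \<and> d \<in> h \<longrightarrow> p \<in> h) \<and> (c \<notin> h \<and> d \<notin> h \<longrightarrow> p \<notin> h))) \<and>
      (med a b c \<in> h \<longleftrightarrow> (a \<in> h \<and> b \<in> h) \<or> (b \<in> h \<and> c \<in> h) \<or> (c \<in> h \<and> a \<in> h)) \<and>
      (med a b d \<in> h \<longleftrightarrow> (a \<in> h \<and> b \<in> h) \<or> (b \<in> h \<and> d \<in> h) \<or> (d \<in> h \<and> a \<in> h))"
      if h: "h \<in> halfspaces" for h
      by (rule conjI[OF in_intervalD[OF z h] p'[OF h]])
    show "z \<in> interval a b" "z \<in> interval c d"
      by (rule in_intervalI, drule *, argo)+
  qed
qed

lemma intervals_Int:
  assumes "I \<in> intervals" "J \<in> intervals" "I \<inter> J \<noteq> {}"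
  shows "I \<inter> J \<in> intervals"
proof -
  obtain a b c d where IJ: "I = interval a b" "J = interval c d"
    using assms(1,2) by (auto simp: intervals_def)
  then obtain p where "p \<in> interval a b" "p \<in> interval c d" using assms(3) by blast
  then show ?thesis unfolding IJ by (simp add: interval_Int)
qed

lemma ex_separated_interval:
  assumes "h \<in> halfspaces"
  obtains x y where "h \<in> hs_separating (interval x y)"
proof -
  obtain x y where "x \<in> h" "y \<notin> h" using assms by (auto simp: halfspaces_def)
  then show thesis
    using that[of x y] assms by (simp add: hs_separating_interval hs_between_def)
qed


section \<open>The Roller compactification\<close>

lemma roller_in: "\<xi> \<in> roller \<Longrightarrow> I \<in> intervals \<Longrightarrow> \<xi> I \<in> I"
  by (auto simp: roller_def)

lemma roller_coherent:
  "\<xi> \<in> roller \<Longrightarrow> I \<in> intervals \<Longrightarrow> J \<in> intervals \<Longrightarrow> I \<inter> J \<noteq> {} \<Longrightarrow>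
    iproj (I \<inter> J) (\<xi> I) = iproj (I \<inter> J) (\<xi> J)"
  unfolding roller_def by blast

lemma roller_iproj:
  assumes "\<xi> \<in> roller" "I \<in> intervals" "K \<in> intervals" "K \<subseteq> I"
  shows "iproj K (\<xi> I) = \<xi> K"
proof -
  have K: "\<xi> K \<in> K" using assms(1,3) by (rule roller_in)
  have "I \<inter> K = K" using assms(4) by blast
  then have "iproj K (\<xi> I) = iproj K (\<xi> K)"
    using roller_coherent[OF assms(1-3)] K by auto
  then show ?thesis using iproj_self[OF assms(3) K] by simp
qed

lemma roller_halfspace_subset:
  assumes "\<xi> \<in> roller" "I \<in> intervals" "K \<in> intervals" "K \<subseteq> I" "h \<in> hs_separating K"
  shows "\<xi> I \<in> h \<longleftrightarrow> \<xi> K \<in> h"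
  using roller_iproj[OF assms(1-4)] iproj_halfspace[OF assms(3,5)] by metis

lemma interval_subset_intervals:
  assumes "I \<in> intervals" "u \<in> I" "v \<in> I"
  shows "interval u v \<subseteq> I"
  using assms interval_convex by (auto simp: intervals_def)

text \<open>Both intervals contain the interval from \<open>u\<close> to \<open>med u v w\<close>.
  The halfspace still splits it, because this median is on the side of \<open>v\<close> and
  \<open>w\<close>; coherence then transfers the coordinate.\<close>

lemma roller_halfspace_vertex:
  assumes "\<xi> \<in> roller" "h \<in> halfspaces" "u \<in> h \<longleftrightarrow> v \<notin> h" "u \<in> h \<longleftrightarrow> w \<notin> h"
  shows "\<xi> (interval u v) \<in> h \<longleftrightarrow> \<xi> (interval u w) \<in> h"
proof -
  let ?K = "interval u (med u v w)"
  have "?K \<subseteq> interval u v" "?K \<subseteq> interval u w"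
    by (simp_all add: interval_subset_intervals)
  moreover have "h \<in> hs_separating ?K"
    using assms(2-4) by (simp add: hs_separating_interval hs_between_def med_in_halfspace)
  ultimately have "\<xi> (interval u v) \<in> h \<longleftrightarrow> \<xi> ?K \<in> h" "\<xi> (interval u w) \<in> h \<longleftrightarrow> \<xi> ?K \<in> h"
    by (simp_all add: roller_halfspace_subset[OF assms(1)])
  then show ?thesis by simp
qed

text \<open>Shrink \<open>I\<close> to an interval whose endpoints are separated by
  \<open>h\<close>, exchange the endpoints one at a time for those of a similar interval inside
  \<open>J\<close>, and enlarge to \<open>J\<close>. Thus any splitting interval may be used to
  decide membership in \<open>sigma_roller\<close>.\<close>

lemma roller_halfspace:
  assumes \<xi>: "\<xi> \<in> roller" and I: "I \<in> intervals" "h \<in> hs_separating I"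
    and J: "J \<in> intervals" "h \<in> hs_separating J"
  shows "\<xi> I \<in> h \<longleftrightarrow> \<xi> J \<in> h"
proof -
  have h: "h \<in> halfspaces" using I(2) by (rule hs_separating_halfspace)
  obtain u v where uv: "u \<in> I" "u \<in> h" "v \<in> I" "v \<notin> h" using I(2) by (auto simp: hs_separating_def)
  obtain u' v' where uv': "u' \<in> J" "u' \<in> h" "v' \<in> J" "v' \<notin> h" using J(2) by (auto simp: hs_separating_def)
  have "\<xi> I \<in> h \<longleftrightarrow> \<xi> (interval u v) \<in> h"
    using uv I h by (intro roller_halfspace_subset[OF \<xi>])
      (simp_all add: interval_subset_intervals hs_separating_interval hs_between_def)
  also have "\<dots> \<longleftrightarrow> \<xi> (interval u v') \<in> h"
    using uv uv' by (intro roller_halfspace_vertex[OF \<xi> h]) auto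
  also have "\<dots> \<longleftrightarrow> \<xi> (interval u' v') \<in> h"
    using roller_halfspace_vertex[OF \<xi> h, of v' u u'] uv uv' by (simp add: interval_commute)
  also have "\<dots> \<longleftrightarrow> \<xi> J \<in> h"
    using uv' J h by (intro roller_halfspace_subset[OF \<xi>, symmetric])
      (simp_all add: interval_subset_intervals hs_separating_interval hs_between_def)
  finally show ?thesis .
qed

lemma sigma_roller_iff:
  assumes "\<xi> \<in> roller" "I \<in> intervals" "h \<in> hs_separating I"
  shows "h \<in> sigma_roller \<xi> \<longleftrightarrow> \<xi> I \<in> h"
proof
  assume "h \<in> sigma_roller \<xi>"
  then obtain J where "J \<in> intervals" "h \<in> hs_separating J" "\<xi> J \<in> h"
    by (auto simp: sigma_roller_def hs_separating_def)
  then show "\<xi> I \<in> h" using roller_halfspace[OF assms] by blast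
next
  assume "\<xi> I \<in> h"
  then show "h \<in> sigma_roller \<xi>"
    using assms by (auto simp: sigma_roller_def hs_separating_def)
qed

lemma hs_ultrafilter_sigma_roller:
  fixes \<xi> :: "'a::median_space set \<Rightarrow> 'a"
  assumes \<xi>: "\<xi> \<in> roller"
  shows "hs_ultrafilter (sigma_roller \<xi>)"
  unfolding hs_ultrafilter_def
proof (intro conjI ballI notI)
  show "sigma_roller \<xi> \<subseteq> halfspaces" by (auto simp: sigma_roller_def)
  fix h :: "'a set" assume h: "h \<in> halfspaces"
  then obtain x y where "h \<in> hs_separating (interval x y)" by (rule ex_separated_interval)
  moreover from this have "- h \<in> hs_separating (interval x y)" by (auto simp: hs_separating_def)
  ultimately show "h \<in> sigma_roller \<xi> \<or> - h \<in> sigma_roller \<xi>"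
    by (simp add: sigma_roller_iff[OF \<xi> interval_in_intervals])
next
  fix h k assume hk: "h \<in> sigma_roller \<xi>" "k \<in> sigma_roller \<xi>" "h \<inter> k = {}"
  then have H: "h \<in> halfspaces" "k \<in> halfspaces" by (auto simp: sigma_roller_def)
  then obtain u v where "u \<in> h" "v \<in> k" by (auto simp: halfspaces_def)
  \<comment> \<open>An interval running from one halfspace to the other is split by both, so its
    coordinate would lie in two disjoint sets.\<close>
  then have "h \<in> hs_separating (interval u v)" "k \<in> hs_separating (interval u v)"
    using hk(3) H by (auto simp: hs_separating_interval hs_between_def)
  then have "\<xi> (interval u v) \<in> h" "\<xi> (interval u v) \<in> k"
    using hk(1,2) by (simp_all add: sigma_roller_iff[OF \<xi> interval_in_intervals])
  then show False using hk(3) by blast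
qed

text \<open>The trace on \<open>hs_between x y\<close> is exactly the halfspace-interval from
  \<open>x\<close> to the coordinate at \<open>interval x y\<close>.\<close>

lemma morally_measurable_sigma_roller:
  assumes \<xi>: "\<xi> \<in> roller"
  shows "morally_measurable (sigma_roller \<xi>)"
  unfolding morally_measurable_def
proof (intro conjI allI)
  show "sigma_roller \<xi> \<subseteq> halfspaces" by (auto simp: sigma_roller_def)
  fix x y
  have p: "\<xi> (interval x y) \<in> interval x y" by (rule roller_in[OF \<xi>]) simp
  have "sigma_roller \<xi> \<inter> hs_between x y = hs_between x (\<xi> (interval x y))"
  proof (rule set_eqI)
    fix h
    show "h \<in> sigma_roller \<xi> \<inter> hs_between x y \<longleftrightarrow> h \<in> hs_between x (\<xi> (interval x y))"
    proof (cases "h \<in> hs_between x y")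
      case True
      then have "h \<in> hs_separating (interval x y)" by (simp add: hs_separating_interval)
      then show ?thesis
        using True sigma_roller_iff[OF \<xi>, of "interval x y" h] by (auto simp: hs_between_def)
    next
      case False
      then show ?thesis using in_intervalD[OF p, of h] by (auto simp: hs_between_def)
    qed
  qed
  then show "sigma_roller \<xi> \<inter> hs_between x y \<in> sets (completion hs_measure)" by simp
qed

lemma roller_eqI:
  assumes "\<xi> \<in> roller" "\<eta> \<in> roller" "\<And>I. I \<in> intervals \<Longrightarrow> \<xi> I = \<eta> I"
  shows "\<xi> = \<eta>"
  using assms unfolding roller_def by (intro PiE_ext[of _ intervals "\<lambda>I. I"]) auto

lemma roller_med_closed:
  assumes "\<xi> \<in> roller" "\<eta> \<in> roller" "\<zeta> \<in> roller"
  shows "roller_med \<xi> \<eta> \<zeta> \<in> roller"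
proof -
  have "iproj (I \<inter> J) (roller_med \<xi> \<eta> \<zeta> I) = iproj (I \<inter> J) (roller_med \<xi> \<eta> \<zeta> J)"
    if IJ: "I \<in> intervals" "J \<in> intervals" "I \<inter> J \<noteq> {}" for I J
  proof -
    show ?thesis
      using IJ assms[THEN roller_coherent[OF _ IJ]]
      by (simp add: roller_med_def iproj_med intervals_Int)
  qed
  moreover have "roller_med \<xi> \<eta> \<zeta> \<in> (\<Pi>\<^sub>E I\<in>intervals. I)"
    using assms by (simp add: roller_med_def med_in_intervals roller_in)
  ultimately show ?thesis unfolding roller_def by blast
qed

lemma roller_embed_in: "roller_embed x \<in> roller"
  by (auto simp: roller_def roller_embed_def iproj_in iproj_iproj intervals_Int)

lemma sigma_roller_embed: "sigma_roller (roller_embed x) = sigma_point x"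
proof (rule set_eqI)
  fix h
  show "h \<in> sigma_roller (roller_embed x) \<longleftrightarrow> h \<in> sigma_point x"
  proof (cases "h \<in> halfspaces")
    case True
    then obtain a b where "h \<in> hs_separating (interval a b)" by (rule ex_separated_interval)
    then show ?thesis
      using True sigma_roller_iff[OF roller_embed_in interval_in_intervals, of h a b x]
      by (simp add: sigma_point_def roller_embed_def iproj_halfspace)
  qed (auto simp: sigma_roller_def sigma_point_def)
qed

lemma sigma_roller_med:
  assumes "\<xi> \<in> roller" "\<eta> \<in> roller" "\<zeta> \<in> roller"
  shows "sigma_roller (roller_med \<xi> \<eta> \<zeta>) = majority (sigma_roller \<xi>) (sigma_roller \<eta>) (sigma_roller \<zeta>)"
proof (rule set_eqI)
  fix h
  show "h \<in> sigma_roller (roller_med \<xi> \<eta> \<zeta>) \<longleftrightarrow>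
    h \<in> majority (sigma_roller \<xi>) (sigma_roller \<eta>) (sigma_roller \<zeta>)"
  proof (cases "h \<in> halfspaces")
    case True
    then obtain a b where "h \<in> hs_separating (interval a b)" by (rule ex_separated_interval)
    note * = sigma_roller_iff[OF _ interval_in_intervals this]
    have "h \<in> sigma_roller (roller_med \<xi> \<eta> \<zeta>) \<longleftrightarrow> roller_med \<xi> \<eta> \<zeta> (interval a b) \<in> h"
      using assms by (intro * roller_med_closed)
    then show ?thesis
      using assms True by (simp add: majority_def * roller_med_def med_in_halfspace)
  qed (auto simp: sigma_roller_def majority_def)
qed

section \<open>The median algebra laws, checked on halfspaces\<close>

lemma sigma_point_med:
  "sigma_point (med x y z) = majority (sigma_point x) (sigma_point y) (sigma_point z)"
  by (auto simp: sigma_point_def majority_def med_in_halfspace)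

lemma med_idem: "med a a b = a"
  by (rule eq_by_halfspaces) (auto simp: med_in_halfspace)

lemma med_commute: "med a b c = med b a c" "med a b c = med b c a"
  by (rule eq_by_halfspaces, auto simp: med_in_halfspace)+

lemma med_assoc: "med (med a x b) x c = med a x (med b x c)"
  by (rule eq_by_halfspaces) (auto simp: med_in_halfspace)

lemma median_algebra_med: "median_algebra (UNIV :: 'a::median_space set) med"
  unfolding median_algebra_def
  by (intro conjI ballI UNIV_I med_idem med_commute med_assoc)

lemma median_algebra_roller: "median_algebra (roller :: ('a::median_space set \<Rightarrow> 'a) set) roller_med"
  unfolding median_algebra_def
proof (intro conjI ballI roller_med_closed)
  fix \<xi> \<eta> \<zeta> \<theta> :: "'a set \<Rightarrow> 'a" assume "\<xi> \<in> roller" "\<eta> \<in> roller"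
  then show "roller_med \<xi> \<xi> \<eta> = \<xi>"
    by (intro roller_eqI roller_med_closed) (simp_all add: roller_med_def med_idem)
next
  fix \<xi> \<eta> \<zeta> \<theta> :: "'a set \<Rightarrow> 'a"
  show "roller_med \<xi> \<eta> \<zeta> = roller_med \<eta> \<xi> \<zeta>" "roller_med \<xi> \<eta> \<zeta> = roller_med \<eta> \<zeta> \<xi>"
    unfolding roller_med_def by (rule restrict_ext, rule med_commute)+
  show "roller_med (roller_med \<xi> \<theta> \<eta>) \<theta> \<zeta> = roller_med \<xi> \<theta> (roller_med \<eta> \<theta> \<zeta>)"
    unfolding roller_med_def by (rule restrict_ext) (simp add: med_assoc)
qed


section \<open>Morally measurable ultrafilters up to null sets\<close>

text \<open>A form of the vanishing of \<open>nu_hat\<close> that is stated with the outer measure,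
  so that subsets and unions can be handled without measurability.\<close>

definition locally_null :: "'a::median_space set set \<Rightarrow> bool" where
  "locally_null E \<longleftrightarrow> (\<forall>x y. hs_outer (E \<inter> hs_between x y) = 0)"

lemma locally_null_subset: "locally_null F \<Longrightarrow> E \<subseteq> F \<Longrightarrow> locally_null E"
  unfolding locally_null_def
  by (metis Int_mono hs_outer_mono le_zero_eq order_refl)

lemma locally_null_Un: "locally_null E \<Longrightarrow> locally_null F \<Longrightarrow> locally_null (E \<union> F)"
  unfolding locally_null_def Int_Un_distrib2
  by (metis add_0 hs_outer_Un le_zero_eq)

text \<open>Families with a single member already detect a halfspace-interval of positive measure;
  conversely every summand is zero.\<close>

lemma nu_hat_eq_0_iff:
  assumes E: "\<And>x y. E \<inter> hs_between x y \<in> sets (completion hs_measure)"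
  shows "nu_hat E = 0 \<longleftrightarrow> locally_null E"
proof
  assume 0: "nu_hat E = 0"
  show "locally_null E"
    unfolding locally_null_def
  proof (intro allI)
    fix x y
    have "hs_outer (E \<inter> hs_between x y) =
      (\<Sum>\<^sub>\<infinity>H\<in>{hs_between x y}. emeasure (completion hs_measure) (E \<inter> H))"
      using E[of x y] by (simp add: emeasure_completion_hs_measure del: emeasure_completion)
    also have "\<dots> \<le> nu_hat E"
      unfolding nu_hat_def by (rule SUP_upper) auto
    finally show "hs_outer (E \<inter> hs_between x y) = 0" using 0 by simp
  qed
next
  assume "locally_null E"
  then have *: "emeasure (completion hs_measure) (E \<inter> H) = 0" if "\<exists>x y. H = hs_between x y" for H
    using that E by (auto simp: locally_null_def emeasure_completion_hs_measure simp del: emeasure_completion)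
  have "nu_hat E \<le> 0"
    unfolding nu_hat_def
  proof (rule SUP_least)
    fix F :: "'a set set set"
    assume "F \<in> {F. F \<subseteq> {H. \<exists>x y. H = hs_between x y} \<and> pairwise disjnt F}"
    then have "(\<Sum>\<^sub>\<infinity>H\<in>F. emeasure (completion hs_measure) (E \<inter> H)) = 0"
      by (intro infsum_0 *) auto
    then show "(\<Sum>\<^sub>\<infinity>H\<in>F. emeasure (completion hs_measure) (E \<inter> H)) \<le> 0" by simp
  qed
  then show "nu_hat E = 0" by simp
qed

lemma mm_rel_iff:
  "(\<sigma>, \<tau>) \<in> mm_rel \<longleftrightarrow>
    \<sigma> \<in> mm_ultrafilters \<and> \<tau> \<in> mm_ultrafilters \<and> locally_null ((\<sigma> - \<tau>) \<union> (\<tau> - \<sigma>))"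
proof -
  have "nu_hat ((\<sigma> - \<tau>) \<union> (\<tau> - \<sigma>)) = 0 \<longleftrightarrow> locally_null ((\<sigma> - \<tau>) \<union> (\<tau> - \<sigma>))"
    if "\<sigma> \<in> mm_ultrafilters" "\<tau> \<in> mm_ultrafilters"
  proof (rule nu_hat_eq_0_iff)
    fix x y
    have "\<sigma> \<inter> hs_between x y \<in> sets (completion hs_measure)" "\<tau> \<inter> hs_between x y \<in> sets (completion hs_measure)"
      using that by (auto simp: mm_ultrafilters_def morally_measurable_def)
    moreover have "((\<sigma> - \<tau>) \<union> (\<tau> - \<sigma>)) \<inter> hs_between x y =
      (\<sigma> \<inter> hs_between x y - \<tau> \<inter> hs_between x y) \<union> (\<tau> \<inter> hs_between x y - \<sigma> \<inter> hs_between x y)" by blast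
    ultimately show "((\<sigma> - \<tau>) \<union> (\<tau> - \<sigma>)) \<inter> hs_between x y \<in> sets (completion hs_measure)"
      by simp
  qed
  then show ?thesis by (auto simp: mm_rel_def)
qed

lemma equiv_mm_rel: "equiv mm_ultrafilters (mm_rel :: ('a::median_space set set \<times> 'a set set) set)"
proof (rule equivI)
  show "mm_rel \<subseteq> mm_ultrafilters \<times> mm_ultrafilters" by (auto simp: mm_rel_iff)
  show "refl_on mm_ultrafilters mm_rel"
    by (auto simp: refl_on_def mm_rel_iff locally_null_def)
  show "sym mm_rel" by (auto simp: sym_def mm_rel_iff Un_commute)
  have "(\<rho>, \<tau>) \<in> mm_rel" if "(\<rho>, \<sigma>) \<in> mm_rel" "(\<sigma>, \<tau>) \<in> mm_rel" for \<rho> \<sigma> \<tau> :: "'a set set"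
  proof -
    have "locally_null ((\<rho> - \<sigma>) \<union> (\<sigma> - \<rho>) \<union> ((\<sigma> - \<tau>) \<union> (\<tau> - \<sigma>)))"
      using that unfolding mm_rel_iff by (intro locally_null_Un[of "_ - _ \<union> _"]) blast+
    then have "locally_null ((\<rho> - \<tau>) \<union> (\<tau> - \<rho>))"
      by (rule locally_null_subset) blast
    then show ?thesis using that by (simp add: mm_rel_iff)
  qed
  then show "trans (mm_rel :: ('a set set \<times> 'a set set) set)" by (rule transI)
qed

section \<open>The median on classes of measurable ultrafilters\<close>

lemma mm_class_eq_iff:
  "\<sigma> \<in> mm_ultrafilters \<Longrightarrow> \<tau> \<in> mm_ultrafilters \<Longrightarrow> mm_class \<sigma> = mm_class \<tau> \<longleftrightarrow> (\<sigma>, \<tau>) \<in> mm_rel"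
  unfolding mm_class_def by (rule eq_equiv_class_iff[OF equiv_mm_rel])

lemma mm_class_in_Mbar: "\<sigma> \<in> mm_ultrafilters \<Longrightarrow> mm_class \<sigma> \<in> Mbar"
  by (auto simp: mm_class_def Mbar_def intro: quotientI)

lemma MbarE:
  assumes "P \<in> Mbar"
  obtains \<sigma> where "\<sigma> \<in> mm_ultrafilters" "P = mm_class \<sigma>"
  using assms unfolding mm_class_def Mbar_def by (rule quotientE)

lemma majority_commute: "majority A B C = majority B A C" "majority A B C = majority B C A"
  by (auto simp: majority_def)

lemma majority_mm:
  assumes "\<sigma> \<in> mm_ultrafilters" "\<tau> \<in> mm_ultrafilters" "\<rho> \<in> mm_ultrafilters"
  shows "majority \<sigma> \<tau> \<rho> \<in> mm_ultrafilters"
proof -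
  have "majority \<sigma> \<tau> \<rho> \<inter> hs_between x y \<in> sets (completion hs_measure)" for x y
  proof -
    have "\<theta> \<inter> hs_between x y \<in> sets (completion hs_measure)" if "\<theta> \<in> mm_ultrafilters" for \<theta>
      using that by (simp add: mm_ultrafilters_def morally_measurable_def)
    moreover have "majority \<sigma> \<tau> \<rho> \<inter> hs_between x y =
      majority (\<sigma> \<inter> hs_between x y) (\<tau> \<inter> hs_between x y) (\<rho> \<inter> hs_between x y)"
      by (auto simp: majority_def)
    ultimately show ?thesis using assms by (simp add: majority_def)
  qed
  moreover have sub: "majority \<sigma> \<tau> \<rho> \<subseteq> halfspaces"
    using assms by (auto simp: majority_def mm_ultrafilters_def morally_measurable_def)
  moreover have "hs_ultrafilter (majority \<sigma> \<tau> \<rho>)"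
  proof -
    have *: "hs_ultrafilter \<sigma>" "hs_ultrafilter \<tau>" "hs_ultrafilter \<rho>"
      using assms by (auto simp: mm_ultrafilters_def)
    have "h \<inter> k \<noteq> {}" if "h \<in> majority \<sigma> \<tau> \<rho>" "k \<in> majority \<sigma> \<tau> \<rho>" for h k
    proof -
      \<comment> \<open>Two out of three for \<open>h\<close> and two out of three for
        \<open>k\<close> must have an ultrafilter in common.\<close>
      have "(h \<in> \<sigma> \<and> k \<in> \<sigma>) \<or> (h \<in> \<tau> \<and> k \<in> \<tau>) \<or> (h \<in> \<rho> \<and> k \<in> \<rho>)"
        using that unfolding majority_def Un_iff Int_iff by argo
      then show ?thesis using * by (elim disjE) (simp_all add: hs_ultrafilter_def)
    qed
    moreover have "h \<in> majority \<sigma> \<tau> \<rho> \<or> - h \<in> majority \<sigma> \<tau> \<rho>" if "h \<in> halfspaces" for h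
    proof -
      have "h \<in> \<theta> \<or> - h \<in> \<theta>" if "hs_ultrafilter \<theta>" for \<theta>
        using that \<open>h \<in> halfspaces\<close> by (simp add: hs_ultrafilter_def)
      from *[THEN this] show ?thesis unfolding majority_def Un_iff Int_iff by argo
    qed
    ultimately show ?thesis
      using sub by (simp add: hs_ultrafilter_def)
  qed
  ultimately show ?thesis by (simp add: mm_ultrafilters_def morally_measurable_def)
qed

lemma majority_mm_rel:
  assumes "(\<sigma>, \<sigma>') \<in> mm_rel" "(\<tau>, \<tau>') \<in> mm_rel" "(\<rho>, \<rho>') \<in> mm_rel"
  shows "(majority \<sigma> \<tau> \<rho>, majority \<sigma>' \<tau>' \<rho>') \<in> mm_rel"
proof -
  have *: "locally_null ((\<sigma> - \<sigma>') \<union> (\<sigma>' - \<sigma>))" "locally_null ((\<tau> - \<tau>') \<union> (\<tau>' - \<tau>))"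
    "locally_null ((\<rho> - \<rho>') \<union> (\<rho>' - \<rho>))"
    using assms by (simp_all add: mm_rel_iff)
  from locally_null_Un[OF *(1) locally_null_Un[OF *(2,3)]] have "locally_null (majority \<sigma> \<tau> \<rho> - majority \<sigma>' \<tau>' \<rho>' \<union> (majority \<sigma>' \<tau>' \<rho>' - majority \<sigma> \<tau> \<rho>))"
    by (rule locally_null_subset) (auto simp: majority_def)
  then show ?thesis using assms by (simp add: mm_rel_iff majority_mm)
qed

lemma Mbar_med_class:
  assumes "\<sigma> \<in> mm_ultrafilters" "\<tau> \<in> mm_ultrafilters" "\<rho> \<in> mm_ultrafilters"
  shows "Mbar_med (mm_class \<sigma>) (mm_class \<tau>) (mm_class \<rho>) = mm_class (majority \<sigma> \<tau> \<rho>)"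
proof -
  have "mm_class (majority \<sigma>' \<tau>' \<rho>') = mm_class (majority \<sigma> \<tau> \<rho>)"
    if "\<sigma>' \<in> mm_class \<sigma>" "\<tau>' \<in> mm_class \<tau>" "\<rho>' \<in> mm_class \<rho>" for \<sigma>' \<tau>' \<rho>'
  proof -
    have "(majority \<sigma> \<tau> \<rho>, majority \<sigma>' \<tau>' \<rho>') \<in> mm_rel"
      using that by (intro majority_mm_rel) (simp_all add: mm_class_def)
    then show ?thesis
      unfolding mm_class_def by (rule equiv_class_eq[OF equiv_mm_rel, symmetric])
  qed
  moreover have "\<theta> \<in> mm_class \<theta>" if "\<theta> \<in> mm_ultrafilters" for \<theta>
    unfolding mm_class_def using that by (rule equiv_class_self[OF equiv_mm_rel])
  ultimately show ?thesis
    using assms unfolding Mbar_med_def by fastforce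
qed

lemma median_algebra_Mbar: "median_algebra Mbar Mbar_med"
  unfolding median_algebra_def
proof (intro conjI ballI)
  fix a b c x :: "'a set set set" assume "a \<in> Mbar" "b \<in> Mbar" "c \<in> Mbar"
  then obtain \<alpha> \<beta> \<gamma> where
    *: "\<alpha> \<in> mm_ultrafilters" "\<beta> \<in> mm_ultrafilters" "\<gamma> \<in> mm_ultrafilters"
    "a = mm_class \<alpha>" "b = mm_class \<beta>" "c = mm_class \<gamma>"
    by (metis MbarE)
  show "Mbar_med a b c \<in> Mbar"
    by (simp add: * Mbar_med_class majority_mm mm_class_in_Mbar)
  show "Mbar_med a b c = Mbar_med b a c" "Mbar_med a b c = Mbar_med b c a"
    using majority_commute[of \<alpha> \<beta> \<gamma>] by (simp_all add: * Mbar_med_class)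
  show "Mbar_med (Mbar_med a x b) x c = Mbar_med a x (Mbar_med b x c)" if x: "x \<in> Mbar"
  proof -
    obtain \<xi> where x': "\<xi> \<in> mm_ultrafilters" "x = mm_class \<xi>" using MbarE[OF x] by blast
    have "majority (majority \<alpha> \<xi> \<beta>) \<xi> \<gamma> = majority \<alpha> \<xi> (majority \<beta> \<xi> \<gamma>)"
      by (auto simp: majority_def)
    then show ?thesis by (simp add: * x' Mbar_med_class majority_mm)
  qed
next
  fix a b :: "'a set set set" assume "a \<in> Mbar" "b \<in> Mbar"
  then obtain \<alpha> \<beta> where
    *: "\<alpha> \<in> mm_ultrafilters" "\<beta> \<in> mm_ultrafilters" "a = mm_class \<alpha>" "b = mm_class \<beta>"
    by (metis MbarE)
  show "Mbar_med a a b = a"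
    by (simp add: * Mbar_med_class) (simp add: majority_def Int_absorb Un_absorb1 inf_commute)
qed

section \<open>Representing classes by points of the Roller compactification\<close>

lemma hs_ultrafilter_Compl:
  assumes "hs_ultrafilter \<sigma>" "h \<in> halfspaces"
  shows "- h \<in> \<sigma> \<longleftrightarrow> h \<notin> \<sigma>"
proof -
  have "h \<inter> - h = {}" by simp
  then show ?thesis using assms unfolding hs_ultrafilter_def by metis
qed

text \<open>Complementation exchanges \<open>hs_between u v\<close> and
  \<open>hs_between v u\<close>, which have the same length. This carries estimates over to the
  halfspaces separating an interval in the opposite direction.\<close>

lemma hs_outer_uminus: "hs_outer (uminus ` E) \<le> hs_outer E"
proof (rule hs_outer_greatest)
  fix u v :: "nat \<Rightarrow> 'a" assume "E \<subseteq> (\<Union>n. hs_between (u n) (v n))"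
  then have "uminus ` E \<subseteq> (\<Union>n. hs_between (v n) (u n))" by (fastforce simp: hs_between_def)
  then have "hs_outer (uminus ` E) \<le> (\<Sum>n. ennreal (dist (v n) (u n)))" by (rule hs_outer_le)
  then show "hs_outer (uminus ` E) \<le> (\<Sum>n. ennreal (dist (u n) (v n)))" by (simp add: dist_commute)
qed

text \<open>The null set consists of the halfspaces on which \<sigma> and \<open>s\<close> disagree.
  Those in \<open>hs_between x y\<close> are covered by \<open>measurable_ultrafilter_point\<close>,
  and the others are complements of such disagreements.\<close>

lemma ex_interval_point:
  fixes I :: "'a::median_space set"
  assumes compl: "complete (UNIV :: 'a set)" and \<sigma>: "\<sigma> \<in> mm_ultrafilters" and I: "I \<in> intervals"
  shows "\<exists>s\<in>I. hs_outer {h \<in> hs_separating I. h \<in> \<sigma> \<longleftrightarrow> s \<notin> h} = 0"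
proof -
  have \<sigma>': "hs_ultrafilter \<sigma>" "morally_measurable \<sigma>" using \<sigma> by (auto simp: mm_ultrafilters_def)
  obtain x y where xy: "I = interval x y" using I by (auto simp: intervals_def)
  obtain s where s: "s \<in> interval x y" "hs_outer (\<sigma> \<inter> hs_between x y - hs_between x s) = 0"
    "hs_outer (hs_between x s - \<sigma>) = 0"
    using measurable_ultrafilter_point[OF compl \<sigma>'] by blast
  let ?E = "(\<sigma> \<inter> hs_between x y - hs_between x s) \<union> (hs_between x s - \<sigma>)"
  have E: "hs_outer ?E = 0" using hs_outer_Un[of "\<sigma> \<inter> hs_between x y - hs_between x s" "hs_between x s - \<sigma>"] s by simp
  have in_E: "h \<in> ?E" if "h \<in> hs_between x y" "h \<in> \<sigma> \<longleftrightarrow> s \<notin> h" for h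
    using that by (auto simp: hs_between_def)
  have "{h \<in> hs_separating I. h \<in> \<sigma> \<longleftrightarrow> s \<notin> h} \<subseteq> ?E \<union> uminus ` ?E"
  proof
    fix h assume "h \<in> {h \<in> hs_separating I. h \<in> \<sigma> \<longleftrightarrow> s \<notin> h}"
    then have h: "h \<in> hs_between x y \<or> h \<in> hs_between y x" "h \<in> \<sigma> \<longleftrightarrow> s \<notin> h"
      by (auto simp: xy hs_separating_interval)
    show "h \<in> ?E \<union> uminus ` ?E"
    proof (cases "h \<in> hs_between x y")
      case True
      then show ?thesis using in_E h(2) by blast
    next
      case False
      then have "h \<in> hs_between y x" using h(1) by blast
      then have "- h \<in> hs_between x y" "- h \<in> \<sigma> \<longleftrightarrow> s \<notin> - h"
        using h(2) hs_ultrafilter_Compl[OF \<sigma>'(1)] by (auto simp: hs_between_def)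
      then have "- h \<in> ?E" by (rule in_E)
      then have "- (- h) \<in> uminus ` ?E" by (rule imageI)
      then show ?thesis by simp
    qed
  qed
  then have "hs_outer {h \<in> hs_separating I. h \<in> \<sigma> \<longleftrightarrow> s \<notin> h} \<le> hs_outer ?E + hs_outer (uminus ` ?E)"
    by (rule order_trans[OF hs_outer_mono hs_outer_Un])
  also have "\<dots> = 0" using E hs_outer_uminus[of ?E] by simp
  finally show ?thesis using s(1) xy by auto
qed

lemma ex_roller_point:
  assumes compl: "complete (UNIV :: 'a::median_space set)" and \<sigma>: "\<sigma> \<in> mm_ultrafilters"
  shows "\<exists>\<xi>\<in>(roller :: ('a set \<Rightarrow> 'a) set). (\<sigma>, sigma_roller \<xi>) \<in> mm_rel"
proof -
  define D where "D I s = {h \<in> hs_separating I. h \<in> \<sigma> \<longleftrightarrow> s \<notin> h}" for I s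
  have "\<forall>I\<in>intervals. \<exists>s. s \<in> I \<and> hs_outer (D I s) = 0"
    using ex_interval_point[OF compl \<sigma>] unfolding D_def by blast
  from bchoice[OF this] obtain f where f: "\<And>I. I \<in> intervals \<Longrightarrow> f I \<in> I"
    "\<And>I. I \<in> intervals \<Longrightarrow> hs_outer (D I (f I)) = 0" by blast
  define \<xi> where "\<xi> = (\<lambda>I\<in>intervals. f I)"
  have "iproj (I \<inter> J) (f I) = iproj (I \<inter> J) (f J)"
    if IJ: "I \<in> intervals" "J \<in> intervals" "I \<inter> J \<noteq> {}" for I J
  proof -
    let ?K = "I \<inter> J"
    let ?a = "iproj ?K (f I)" and ?b = "iproj ?K (f J)"
    have K: "?K \<in> intervals" using IJ by (rule intervals_Int)
    \<comment> \<open>A halfspace between the two projections splits \<open>?K\<close> and has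
      \<open>f I\<close> and \<open>f J\<close> on different sides, so \<sigma> disagrees with one
      of them. Hence these halfspaces form a null set and the projections are at distance
      zero.\<close>
    have "hs_between ?a ?b \<subseteq> D I (f I) \<union> D J (f J)"
    proof
      fix h assume h: "h \<in> hs_between ?a ?b"
      then have sep: "h \<in> hs_separating ?K"
        using iproj_in[OF K] by (auto simp: hs_separating_def hs_between_def)
      then have "h \<in> hs_separating I" "h \<in> hs_separating J"
        by (auto elim: hs_separating_subset)
      moreover have "f I \<notin> h" "f J \<in> h"
        using h iproj_halfspace[OF K sep] by (auto simp: hs_between_def)
      ultimately show "h \<in> D I (f I) \<union> D J (f J)" by (auto simp: D_def)
    qed
    then have "hs_outer (hs_between ?a ?b) \<le> hs_outer (D I (f I)) + hs_outer (D J (f J))"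
      by (rule order_trans[OF hs_outer_mono hs_outer_Un])
    then show ?thesis using f(2)[OF IJ(1)] f(2)[OF IJ(2)] by (simp add: ennreal_eq_0_iff)
  qed
  then have \<xi>: "\<xi> \<in> roller" using f(1) by (auto simp: roller_def \<xi>_def)
  have "locally_null ((\<sigma> - sigma_roller \<xi>) \<union> (sigma_roller \<xi> - \<sigma>))"
    unfolding locally_null_def
  proof (intro allI)
    fix x y
    have "((\<sigma> - sigma_roller \<xi>) \<union> (sigma_roller \<xi> - \<sigma>)) \<inter> hs_between x y \<subseteq> D (interval x y) (f (interval x y))"
    proof
      fix h assume h: "h \<in> ((\<sigma> - sigma_roller \<xi>) \<union> (sigma_roller \<xi> - \<sigma>)) \<inter> hs_between x y"
      then have sep: "h \<in> hs_separating (interval x y)" by (simp add: hs_separating_interval)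
      then show "h \<in> D (interval x y) (f (interval x y))"
        using h sigma_roller_iff[OF \<xi> interval_in_intervals sep] by (auto simp: D_def \<xi>_def)
    qed
    then have "hs_outer (((\<sigma> - sigma_roller \<xi>) \<union> (sigma_roller \<xi> - \<sigma>)) \<inter> hs_between x y)
      \<le> hs_outer (D (interval x y) (f (interval x y)))"
      by (rule hs_outer_mono)
    then show "hs_outer (((\<sigma> - sigma_roller \<xi>) \<union> (sigma_roller \<xi> - \<sigma>)) \<inter> hs_between x y) = 0"
      by (simp add: f(2))
  qed
  moreover have "sigma_roller \<xi> \<in> mm_ultrafilters"
    using \<xi> by (simp add: mm_ultrafilters_def hs_ultrafilter_sigma_roller morally_measurable_sigma_roller)
  ultimately have "(\<sigma>, sigma_roller \<xi>) \<in> mm_rel" using \<sigma> by (simp add: mm_rel_iff)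
  then show ?thesis using \<xi> by blast
qed

text \<open>A null halfspace-interval has endpoints at distance zero. Both injectivity claims, for
  the Roller compactification and for the space itself, reduce to this.\<close>

lemma mm_rel_separates:
  assumes "(\<sigma>, \<tau>) \<in> mm_rel" "hs_between x y \<subseteq> \<tau> - \<sigma>"
  shows "x = y"
proof -
  have "hs_between x y = (\<sigma> - \<tau> \<union> (\<tau> - \<sigma>)) \<inter> hs_between x y" using assms(2) by blast
  then have "hs_outer (hs_between x y) = 0"
    using assms(1) unfolding mm_rel_iff locally_null_def by metis
  then show ?thesis by (simp add: ennreal_eq_0_iff)
qed

lemma sigma_roller_inj:
  assumes \<xi>: "\<xi> \<in> roller" and \<eta>: "\<eta> \<in> roller" and rel: "(sigma_roller \<xi>, sigma_roller \<eta>) \<in> mm_rel"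
  shows "\<xi> = \<eta>"
proof (rule roller_eqI[OF \<xi> \<eta>])
  fix I :: "'a set" assume I: "I \<in> intervals"
  show "\<xi> I = \<eta> I"
  proof (rule mm_rel_separates[OF rel], rule subsetI)
    \<comment> \<open>Both coordinates lie in \<open>I\<close>, so a halfspace between them splits
      \<open>I\<close> and membership in both ultrafilters can be read off there.\<close>
    fix h assume h: "h \<in> hs_between (\<xi> I) (\<eta> I)"
    then have "h \<in> hs_separating I"
      using roller_in[OF \<xi> I] roller_in[OF \<eta> I] by (auto simp: hs_separating_def hs_between_def)
    then show "h \<in> sigma_roller \<eta> - sigma_roller \<xi>"
      using h sigma_roller_iff[OF \<xi> I] sigma_roller_iff[OF \<eta> I] by (simp add: hs_between_def)
  qed
qed

theorem theorem4p15:
  assumes complete: "complete (UNIV :: 'a::median_space set)"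
    and compact_intervals: "\<And>x y :: 'a. compact (interval x y)"
    and locally_convex: "\<And>(x :: 'a) U. open U \<Longrightarrow> x \<in> U \<Longrightarrow>
                           \<exists>C. med_convex C \<and> x \<in> interior C \<and> C \<subseteq> U"
  shows "(\<forall>\<xi> \<in> (roller :: ('a set \<Rightarrow> 'a) set).
            hs_ultrafilter (sigma_roller \<xi>) \<and> morally_measurable (sigma_roller \<xi>))
       \<and> median_iso (roller :: ('a set \<Rightarrow> 'a) set) roller_med Mbar Mbar_med
            (\<lambda>\<xi>. mm_class (sigma_roller \<xi>))
       \<and> median_mono (UNIV :: 'a set) med Mbar Mbar_med (\<lambda>x. mm_class (sigma_point x))
       \<and> (\<forall>x :: 'a. roller_embed x \<in> roller \<and>
            mm_class (sigma_roller (roller_embed x)) = mm_class (sigma_point x))"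
proof (intro conjI ballI allI)
  have mm: "sigma_roller \<xi> \<in> mm_ultrafilters" if "\<xi> \<in> roller" for \<xi> :: "'a set \<Rightarrow> 'a"
    using that by (simp add: mm_ultrafilters_def hs_ultrafilter_sigma_roller morally_measurable_sigma_roller)
  \<comment> \<open>The ultrafilter of a point of the space is that of its image under
    \<open>roller_embed\<close>, so it inherits measurability.\<close>
  have mm_point: "sigma_point x \<in> mm_ultrafilters" for x :: 'a
    using mm[OF roller_embed_in[of x]] by (simp add: sigma_roller_embed)
  show "median_iso (roller :: ('a set \<Rightarrow> 'a) set) roller_med Mbar Mbar_med (\<lambda>\<xi>. mm_class (sigma_roller \<xi>))"
    unfolding median_iso_def median_hom_def
  proof (intro conjI ballI)
    show "median_algebra (roller :: ('a set \<Rightarrow> 'a) set) roller_med" by (rule median_algebra_roller)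
    show "median_algebra (Mbar :: 'a set set set set) Mbar_med" by (rule median_algebra_Mbar)
    show "(\<lambda>\<xi>. mm_class (sigma_roller \<xi>)) \<in> roller \<rightarrow> (Mbar :: 'a set set set set)"
      by (simp add: mm mm_class_in_Mbar)
    show "mm_class (sigma_roller (roller_med \<xi> \<eta> \<zeta>)) =
      Mbar_med (mm_class (sigma_roller \<xi>)) (mm_class (sigma_roller \<eta>)) (mm_class (sigma_roller \<zeta>))"
      if "\<xi> \<in> roller" "\<eta> \<in> roller" "\<zeta> \<in> roller" for \<xi> \<eta> \<zeta> :: "'a set \<Rightarrow> 'a"
      using that by (simp add: Mbar_med_class mm sigma_roller_med)
    show "bij_betw (\<lambda>\<xi>. mm_class (sigma_roller \<xi>)) roller (Mbar :: 'a set set set set)"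
      unfolding bij_betw_def
    proof
      show "inj_on (\<lambda>\<xi>. mm_class (sigma_roller \<xi>)) (roller :: ('a set \<Rightarrow> 'a) set)"
        by (rule inj_onI) (simp add: mm_class_eq_iff mm sigma_roller_inj)
      show "(\<lambda>\<xi>. mm_class (sigma_roller \<xi>)) ` roller = (Mbar :: 'a set set set set)"
      proof (intro equalityI subsetI)
        fix P :: "'a set set set" assume "P \<in> Mbar"
        then obtain \<sigma> where \<sigma>: "\<sigma> \<in> mm_ultrafilters" "P = mm_class \<sigma>" by (rule MbarE)
        obtain \<xi> where "\<xi> \<in> roller" "(\<sigma>, sigma_roller \<xi>) \<in> mm_rel"
          using ex_roller_point[OF complete \<sigma>(1)] by blast
        then show "P \<in> (\<lambda>\<xi>. mm_class (sigma_roller \<xi>)) ` roller"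
          using \<sigma> mm by (intro image_eqI[of _ _ \<xi>]) (simp_all add: mm_class_eq_iff)
      qed (auto simp: mm mm_class_in_Mbar)
    qed
  qed
  show "median_mono (UNIV :: 'a set) med Mbar Mbar_med (\<lambda>x. mm_class (sigma_point x))"
    unfolding median_mono_def median_hom_def
  proof (intro conjI ballI)
    show "median_algebra (UNIV :: 'a set) med" by (rule median_algebra_med)
    show "median_algebra (Mbar :: 'a set set set set) Mbar_med" by (rule median_algebra_Mbar)
    show "(\<lambda>x. mm_class (sigma_point x)) \<in> (UNIV :: 'a set) \<rightarrow> Mbar"
      by (simp add: mm_point mm_class_in_Mbar)
    show "mm_class (sigma_point (med x y z)) =
      Mbar_med (mm_class (sigma_point x)) (mm_class (sigma_point y)) (mm_class (sigma_point z))"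
      for x y z :: 'a
      by (simp add: Mbar_med_class mm_point sigma_point_med)
    show "inj_on (\<lambda>x. mm_class (sigma_point x)) (UNIV :: 'a set)"
    proof (rule inj_onI)
      fix x y :: 'a assume "mm_class (sigma_point x) = mm_class (sigma_point y)"
      then have "(sigma_point x, sigma_point y) \<in> mm_rel" by (simp add: mm_class_eq_iff mm_point)
      then show "x = y"
        by (rule mm_rel_separates) (auto simp: sigma_point_def hs_between_def)
    qed
  qed
qed (simp_all add: hs_ultrafilter_sigma_roller morally_measurable_sigma_roller roller_embed_in
    sigma_roller_embed)

end
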